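(* Let $b\ge 2$ and $k\ge 2$ be integers, let $r\in\mathbb{R}$, and let $f\in\mathcal{A}_r$ be multiplicative. Then for every $\epsilon>0$, \[\sum_{n_1,n_2,\dots,n_k\le x}f([n_1, \dots , n_k]_b)=C^b_{f,k}\frac{x^{k(r+1)}}{(r+1)^k}+O_b\left(x^{k(r+1)-\frac{1}{2}\min(r+1,1)+\epsilon}\right),\] where \[C^b_{f,k}=\prod_p\left(1-\frac{1}{p}\right)^k\sum_{v_1,\dots,v_k=0}^\infty \frac{f\left(p^{\lceil\max(v_1,\dots,v_k)/b\rceil}\right)}{p^{(r+1)(v_1+\cdots+v_k)}},\] the product running over all primes $p$.
   Context: For an integer $b\ge 1$ and positive integers $n_1,\dots,n_k$, the generalized lcm is $[n_1,\dots,n_k]_b:=\min\{d\ge 1: n_1\mid d^b,\dots,n_k\mid d^b\}$. For $r\in\mathbb{R}$, $\mathcal{A}_r$ is the class of complex-valued multiplicative arithmetic functions $f$ for which there exist constants $C_1,C_2$ such that (1) $|f(p)-p^r|\le C_1p^{r-1/2}$ for all primes $p$, and (2) $|f(p^v)|\le C_2p^{vr}$ for all prime powers $p^v$ with $v\ge 2$. The sum runs over all $k$-tuples of positive integers at most $x$, where $x$ is a real variable tending to infinity. In the error term, $k$, $r$, $f$ and $\epsilon$ are fixed (the implied constant may depend on them as well as on $b$).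
   Formalization: The formal theorem assumes r > -1 instead of any real r: at r = -1 the main term divides by zero, and for r < -1 the claim fails, e.g. for f(n) = n^r the product defining C diverges while the sum is at least 1. *)

theory Defs
  imports "HOL-Analysis.Analysis" "HOL-Library.Landau_Symbols"
    "HOL-Computational_Algebra.Primes"
begin

text \<open>
  A \<open>k\<close>-tuple is a function on \<open>{..<k}\<close> (extensional whenever we sum over tuples).
\<close>

definition gen_lcm :: "nat \<Rightarrow> nat \<Rightarrow> (nat \<Rightarrow> nat) \<Rightarrow> nat" where
  "gen_lcm b k n = (LEAST d. 1 \<le> d \<and> (\<forall>i<k. n i dvd d ^ b))"

text \<open>
  Arithmetic functions live on the positive integers; the value at \<open>0\<close> is irrelevant.
  The condition \<open>f 1 = 1\<close> is the usual convention excluding the zero function.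
\<close>

definition multiplicative_arith :: "(nat \<Rightarrow> complex) \<Rightarrow> bool" where
  "multiplicative_arith f \<longleftrightarrow>
     f 1 = 1 \<and> (\<forall>m n. 0 < m \<longrightarrow> 0 < n \<longrightarrow> coprime m n \<longrightarrow> f (m * n) = f m * f n)"

definition class_A :: "real \<Rightarrow> (nat \<Rightarrow> complex) set" where
  "class_A r = {f. multiplicative_arith f \<and>
     (\<exists>C1::real. \<forall>p::nat. prime p \<longrightarrow>
        cmod (f p - complex_of_real (real p powr r)) \<le> C1 * real p powr (r - 1/2)) \<and>
     (\<exists>C2::real. \<forall>(p::nat) v::nat. prime p \<longrightarrow> 2 \<le> v \<longrightarrow>
        cmod (f (p ^ v)) \<le> C2 * real p powr (real v * r))}"

definition pos_tuples_upto :: "nat \<Rightarrow> real \<Rightarrow> (nat \<Rightarrow> nat) set" where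
  "pos_tuples_upto k x = PiE {..<k} (\<lambda>_. {m::nat. 1 \<le> m \<and> real m \<le> x})"

definition exponent_tuples :: "nat \<Rightarrow> (nat \<Rightarrow> nat) set" where
  "exponent_tuples k = PiE {..<k} (\<lambda>_. UNIV)"

definition local_term ::
    "nat \<Rightarrow> nat \<Rightarrow> real \<Rightarrow> (nat \<Rightarrow> complex) \<Rightarrow> nat \<Rightarrow> (nat \<Rightarrow> nat) \<Rightarrow> complex" where
  "local_term b k r f p v =
     f (p ^ nat \<lceil>real (Max (v ` {..<k})) / real b\<rceil>)
       / complex_of_real (real p powr ((r + 1) * real (\<Sum>i<k. v i)))"

text \<open>
  The Euler product is an infinite product over all natural numbers, in increasing order,
  with factor \<open>1\<close> at the non-primes.
\<close>

definition euler_factor ::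
    "nat \<Rightarrow> nat \<Rightarrow> real \<Rightarrow> (nat \<Rightarrow> complex) \<Rightarrow> nat \<Rightarrow> complex" where
  "euler_factor b k r f p =
     (if prime p
      then (1 - 1 / of_nat p) ^ k * (\<Sum>\<^sub>\<infinity>v\<in>exponent_tuples k. local_term b k r f p v)
      else 1)"

definition euler_const :: "nat \<Rightarrow> nat \<Rightarrow> real \<Rightarrow> (nat \<Rightarrow> complex) \<Rightarrow> complex" where
  "euler_const b k r f = prodinf (euler_factor b k r f)"

end

(*
  Writing a(v) for the value of n_1^(-r) ... n_k^(-r) f([n_1,...,n_k]_b) at the exponent tuple v of a
  prime, take differences of a in each of the k variables.  The resulting multiplicative function
  H of k variables satisfies
    f([n_1,...,n_k]_b) = (n_1 ... n_k)^r * (sum of H(d) over all tuples d with d_i | n_i),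
  and because f(p) is close to p^r, H is so small that the sum of |H(d)| (d_1 ... d_k)^(-(1 - delta))
  converges for every delta < min(r + 1, 1) / 2.  Exchanging summations gives
    sum over d of H(d) * product over i of d_i^r * A(x / d_i),  A(y) = sum of m^r over m <= y.
  Since |A(y) - y^(r+1) / (r+1)| = O(y^(r+1-delta)) for all y > 0, replacing each A(x / d_i) by its
  main term costs O(x^(k(r+1)-delta)), and what remains is x^(k(r+1)) / (r+1)^k times the sum of
  H(d) / (d_1 ... d_k), whose Euler product is the constant of the theorem.
*)
theory Submission
  imports Defs
begin

no_notation Infinite_Set_Sum.abs_summable_on (infix \<open>abs'_summable'_on\<close> 50)

section \<open>Multiplicative functions of several variables\<close>

text \<open>The exponent of the error term is decided at the exponent tuples of total degree one and
  two. At degree one the value of H is f(p)/p^r - 1, of size at most p^(-1/2) up to a constant;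
  against the weight p^(-(1 - \<delta>)) it is summable over p for \<delta> < 1/2. From degree two
  on no cancellation is exploited. For r >= 0 the normalised values are bounded, and the weight
  p^(-2(1 - \<delta>)) again asks for \<delta> < 1/2. For r < 0 the normalisation by n_i^(-r) makes
  values grow: at degree two with lcm exponent one they can reach p^(-r), and p^(-r - 2(1 -
  \<delta>)) is summable only for \<delta> < (r + 1)/2.

  Since H is used only through its values at single primes, multiplicative functions of several
  variables are built from arbitrary local data; multiplicativity is then never a hypothesis on
  them, and absolute convergence is checked one prime at a time.\<close>

definition tuples :: "nat \<Rightarrow> (nat \<Rightarrow> nat) set" where
  "tuples k = PiE {..<k} (\<lambda>_. {0<..})"

definition tdeg :: "nat \<Rightarrow> (nat \<Rightarrow> nat) \<Rightarrow> nat" where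
  "tdeg k v = (\<Sum>i<k. v i)"

definition tzero :: "nat \<Rightarrow> nat \<Rightarrow> nat" where
  "tzero k = (\<lambda>i\<in>{..<k}. 0)"

definition tmult :: "nat \<Rightarrow> nat \<Rightarrow> (nat \<Rightarrow> nat) \<Rightarrow> nat \<Rightarrow> nat" where
  "tmult k p n = (\<lambda>i\<in>{..<k}. multiplicity p (n i))"

definition tprimes :: "nat \<Rightarrow> (nat \<Rightarrow> nat) \<Rightarrow> nat set" where
  "tprimes k n = {p. prime p \<and> (\<exists>i<k. p dvd n i)}"

definition smooth_tuples :: "nat \<Rightarrow> nat set \<Rightarrow> (nat \<Rightarrow> nat) set" where
  "smooth_tuples k P = {n \<in> tuples k. tprimes k n \<subseteq> P}"

definition prime_powers_tuple :: "nat \<Rightarrow> nat set \<Rightarrow> (nat \<Rightarrow> nat \<Rightarrow> nat) \<Rightarrow> nat \<Rightarrow> nat" where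
  "prime_powers_tuple k P w = (\<lambda>i\<in>{..<k}. \<Prod>p\<in>P. p ^ w p i)"

text \<open>The multiplicative function of \<open>k\<close> variables with prescribed local values.
  Primes dividing no component are left out of the product, which fits the normalisation
  \<open>g p (tzero k) = 1\<close> assumed of all local data below.\<close>

definition mult_ext :: "nat \<Rightarrow> (nat \<Rightarrow> (nat \<Rightarrow> nat) \<Rightarrow> 'a) \<Rightarrow> (nat \<Rightarrow> nat) \<Rightarrow> 'a::comm_monoid_mult" where
  "mult_ext k g n = (\<Prod>p\<in>tprimes k n. g p (tmult k p n))"

section \<open>Unique factorization of tuples\<close>

lemma finite_tprimes: "n \<in> tuples k \<Longrightarrow> finite (tprimes k n)"
proof -
  assume n: "n \<in> tuples k"
  have "tprimes k n \<subseteq> (\<Union>i<k. {d. d dvd n i})"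
    by (auto simp: tprimes_def)
  moreover have "finite (\<Union>i<k. {d. d dvd n i})"
    using n by (intro finite_UN_I) (auto simp: tuples_def PiE_iff)
  ultimately show ?thesis by (rule finite_subset)
qed

lemma tprimes_prime: "p \<in> tprimes k n \<Longrightarrow> prime p"
  by (simp add: tprimes_def)

lemma smooth_tuples_tprimes: "n \<in> tuples k \<Longrightarrow> n \<in> smooth_tuples k (tprimes k n)"
  by (simp add: smooth_tuples_def)

lemma tmult_exponent_tuples [simp]: "tmult k p n \<in> exponent_tuples k"
  by (simp add: tmult_def exponent_tuples_def)

lemma tmult_eq_tzero: "prime p \<Longrightarrow> p \<notin> tprimes k n \<Longrightarrow> tmult k p n = tzero k"
  by (auto simp: tmult_def tzero_def tprimes_def not_dvd_imp_multiplicity_0 intro!: restrict_ext)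

lemma tuple_component_eq:
  assumes "n \<in> smooth_tuples k P" "finite P" "\<And>p. p \<in> P \<Longrightarrow> prime p" "i < k"
  shows "n i = (\<Prod>p\<in>P. p ^ multiplicity p (n i))"
proof -
  have pos: "n i > 0" using assms by (auto simp: smooth_tuples_def tuples_def PiE_iff)
  have sub: "prime_factors (n i) \<subseteq> P"
    using assms by (auto simp: smooth_tuples_def tprimes_def prime_factors_dvd)
  have "n i = (\<Prod>p\<in>prime_factors (n i). p ^ multiplicity p (n i))"
    using pos by (simp add: prime_factorization_nat)
  also have "\<dots> = (\<Prod>p\<in>P. p ^ multiplicity p (n i))"
    using sub assms by (intro prod.mono_neutral_left)
      (auto simp: prime_factors_multiplicity)
  finally show ?thesis .
qed

lemma tmult_prime_powers_tuple:
  assumes "finite P" "\<And>p. p \<in> P \<Longrightarrow> prime p" "w p \<in> exponent_tuples k" "p \<in> P"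
  shows "tmult k p (prime_powers_tuple k P w) = w p"
proof
  fix i
  show "tmult k p (prime_powers_tuple k P w) i = w p i"
  proof (cases "i < k")
    case True
    then show ?thesis
      using multiplicity_prod_prime_powers[OF assms(1,2), of p "\<lambda>p. w p i"] assms(2,4)
      by (simp add: tmult_def prime_powers_tuple_def)
  next
    case False
    then have "w p i = undefined"
      using assms(3) by (intro PiE_arb[of "w p"]) (auto simp: exponent_tuples_def)
    then show ?thesis using False by (simp add: tmult_def)
  qed
qed

text \<open>Unique factorization in all coordinates at once; the inverse reads off multiplicities.
  Sums over tuples with primes in \<open>P\<close> thereby become sums over a product set with one
  independent choice per prime.\<close>

lemma bij_betw_prime_powers_tuple:
  assumes "finite P" "\<And>p. p \<in> P \<Longrightarrow> prime p"
  shows "bij_betw (prime_powers_tuple k P) (PiE P (\<lambda>_. exponent_tuples k)) (smooth_tuples k P)"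
proof (rule bij_betwI[where g = "\<lambda>n. \<lambda>p\<in>P. tmult k p n"])
  show "prime_powers_tuple k P \<in> (PiE P (\<lambda>_. exponent_tuples k)) \<rightarrow> smooth_tuples k P"
  proof
    fix w assume w: "w \<in> PiE P (\<lambda>_. exponent_tuples k)"
    have "prime_powers_tuple k P w \<in> tuples k"
      using assms(2) by (auto simp: prime_powers_tuple_def tuples_def prime_gt_0_nat intro!: prod_pos)
    moreover have "tprimes k (prime_powers_tuple k P w) \<subseteq> P"
    proof
      fix q assume "q \<in> tprimes k (prime_powers_tuple k P w)"
      then obtain i where q: "prime q" "i < k" "q dvd (\<Prod>p\<in>P. p ^ w p i)"
        by (auto simp: tprimes_def prime_powers_tuple_def)
      then obtain p where "p \<in> P" "q dvd p ^ w p i"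
        using prime_dvd_prod_iff[OF assms(1) q(1)] by auto
      then show "q \<in> P"
        using q(1) assms(2) primes_dvd_imp_eq prime_dvd_power by metis
    qed
    ultimately show "prime_powers_tuple k P w \<in> smooth_tuples k P"
      by (simp add: smooth_tuples_def)
  qed
  show "(\<lambda>n. \<lambda>p\<in>P. tmult k p n) \<in> smooth_tuples k P \<rightarrow> PiE P (\<lambda>_. exponent_tuples k)"
    by auto
  show "(\<lambda>p\<in>P. tmult k p (prime_powers_tuple k P w)) = w" if "w \<in> PiE P (\<lambda>_. exponent_tuples k)" for w
  proof
    fix p show "(\<lambda>p\<in>P. tmult k p (prime_powers_tuple k P w)) p = w p"
      using that assms by (cases "p \<in> P") (auto simp: tmult_prime_powers_tuple PiE_iff extensional_def)
  qed
  show "prime_powers_tuple k P (\<lambda>p\<in>P. tmult k p n) = n" if n: "n \<in> smooth_tuples k P" for n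
  proof
    fix i show "prime_powers_tuple k P (\<lambda>p\<in>P. tmult k p n) i = n i"
    proof (cases "i < k")
      case True
      then show ?thesis using tuple_component_eq[OF n assms True]
        by (simp add: prime_powers_tuple_def tmult_def)
    next
      case False
      then have "n i = undefined"
        using n by (intro PiE_arb[of n "{..<k}" "\<lambda>_. {0<..}"]) (auto simp: smooth_tuples_def tuples_def)
      then show ?thesis using False by (simp add: prime_powers_tuple_def)
    qed
  qed
qed

text \<open>Exchanges the prime set that depends on \<open>n\<close> for a fixed one, as needed
  before a sum over \<open>n\<close> can be factored. The extra primes see the zero tuple, where
  \<open>g\<close> is 1.\<close>

lemma mult_ext_smooth:
  assumes "n \<in> smooth_tuples k P" "finite P" "\<And>p. p \<in> P \<Longrightarrow> prime p"
    "\<And>p. prime p \<Longrightarrow> g p (tzero k) = 1"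
  shows "mult_ext k g n = (\<Prod>p\<in>P. g p (tmult k p n))"
  unfolding mult_ext_def
  using assms by (intro prod.mono_neutral_left) (auto simp: smooth_tuples_def tmult_eq_tzero)

text \<open>A power weight on the coordinates is itself multiplicative, and at \<open>p\<close> it
  depends only on the total degree. Weights can therefore be moved into the local factors.\<close>

lemma prod_powr_smooth:
  assumes "n \<in> smooth_tuples k P" "finite P" "\<And>p. p \<in> P \<Longrightarrow> prime p"
  shows "(\<Prod>i<k. real (n i) powr s) = (\<Prod>p\<in>P. real p powr (s * real (tdeg k (tmult k p n))))"
proof -
  have "(\<Prod>i<k. real (n i) powr s) = (\<Prod>i<k. \<Prod>p\<in>P. real p powr (s * real (multiplicity p (n i))))"
  proof (intro prod.cong refl)
    fix i assume i: "i \<in> {..<k}"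
    have "real (n i) = (\<Prod>p\<in>P. real p powr real (multiplicity p (n i)))"
    proof -
      have "real (n i) = real (\<Prod>p\<in>P. p ^ multiplicity p (n i))"
        using tuple_component_eq[OF assms] i by simp
      also have "\<dots> = (\<Prod>p\<in>P. real p powr real (multiplicity p (n i)))"
        unfolding of_nat_prod using assms(3) by (intro prod.cong) (auto simp: powr_realpow prime_gt_0_nat)
      finally show ?thesis .
    qed
    then show "real (n i) powr s = (\<Prod>p\<in>P. real p powr (s * real (multiplicity p (n i))))"
      by (simp add: prod_powr_distrib powr_powr mult.commute)
  qed
  also have "\<dots> = (\<Prod>p\<in>P. \<Prod>i<k. real p powr (s * real (multiplicity p (n i))))"
    by (rule prod.swap)
  also have "\<dots> = (\<Prod>p\<in>P. real p powr (s * real (tdeg k (tmult k p n))))"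
    using assms(3) by (intro prod.cong refl)
      (auto simp: tdeg_def tmult_def powr_sum sum_distrib_left prime_gt_0_nat)
  finally show ?thesis .
qed

section \<open>Absolutely convergent sums over tuples and Euler products\<close>

lemma abs_summable_prod_PiE:
  fixes f :: "'a \<Rightarrow> 'b \<Rightarrow> 'c::{real_normed_field}"
  assumes "finite A" "\<And>x. x \<in> A \<Longrightarrow> f x abs_summable_on B x"
  shows "(\<lambda>g. \<Prod>x\<in>A. f x (g x)) abs_summable_on (PiE A B)"
proof (rule nonneg_bdd_above_summable_on)
  show "bdd_above (sum (\<lambda>g. norm (\<Prod>x\<in>A. f x (g x))) ` {F. F \<subseteq> PiE A B \<and> finite F})"
  proof (rule bdd_aboveI2)
    fix F assume F: "F \<in> {F. F \<subseteq> PiE A B \<and> finite F}"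
    \<comment> \<open>The projections of \<open>F\<close>: the finite set \<open>F\<close> lies in
      the box that they span, and over this box the sum of norms is a product of finite sums, each
      at most the full local sum.\<close>
    define C where "C = (\<lambda>x. (\<lambda>g. g x) ` F)"
    have C: "finite (C x)" for x using F by (auto simp: C_def)
    have "(\<Sum>g\<in>F. norm (\<Prod>x\<in>A. f x (g x))) \<le> (\<Sum>g\<in>PiE A C. norm (\<Prod>x\<in>A. f x (g x)))"
      using F assms(1) C by (intro sum_mono2 finite_PiE) (auto simp: C_def PiE_iff)
    also have "\<dots> = (\<Prod>x\<in>A. \<Sum>y\<in>C x. norm (f x y))"
      using assms(1) C by (subst prod_sum_PiE) (auto simp: prod_norm)
    also have "\<dots> \<le> (\<Prod>x\<in>A. infsum (\<lambda>y. norm (f x y)) (B x))"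
      using assms F C by (intro prod_mono conjI sum_nonneg finite_sum_le_infsum) (auto simp: C_def PiE_iff)
    finally show "(\<Sum>g\<in>F. norm (\<Prod>x\<in>A. f x (g x))) \<le> (\<Prod>x\<in>A. infsum (\<lambda>y. norm (f x y)) (B x))" .
  qed
qed auto

text \<open>The finite Euler product. By unique factorization the summand becomes a product of
  functions of independent variables, one for each prime of \<open>P\<close>.\<close>

lemma
  fixes g :: "nat \<Rightarrow> (nat \<Rightarrow> nat) \<Rightarrow> 'a::{banach, real_normed_field}"
  assumes "finite P" "\<And>p. p \<in> P \<Longrightarrow> prime p"
    "\<And>p. prime p \<Longrightarrow> g p (tzero k) = 1"
    "\<And>p. prime p \<Longrightarrow> g p abs_summable_on exponent_tuples k"
  shows abs_summable_mult_ext_smooth: "mult_ext k g abs_summable_on smooth_tuples k P"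
    and infsum_mult_ext_smooth:
      "infsum (mult_ext k g) (smooth_tuples k P) = (\<Prod>p\<in>P. infsum (g p) (exponent_tuples k))"
proof -
  note bij = bij_betw_prime_powers_tuple[OF assms(1,2), of k]
  have eq: "mult_ext k g (prime_powers_tuple k P w) = (\<Prod>p\<in>P. g p (w p))"
    if "w \<in> PiE P (\<lambda>_. exponent_tuples k)" for w
  proof -
    have "prime_powers_tuple k P w \<in> smooth_tuples k P"
      using bij that by (auto dest: bij_betwE)
    then show ?thesis
      using mult_ext_smooth[where g = g] assms that
      by (simp add: tmult_prime_powers_tuple PiE_iff)
  qed
  have "(\<lambda>w. \<Prod>p\<in>P. g p (w p)) abs_summable_on (PiE P (\<lambda>_. exponent_tuples k))"
    using assms by (intro abs_summable_prod_PiE) auto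
  then have "(\<lambda>w. norm (mult_ext k g (prime_powers_tuple k P w))) summable_on (PiE P (\<lambda>_. exponent_tuples k))"
    by (rule summable_on_cong[THEN iffD1, rotated]) (simp add: eq)
  then show "mult_ext k g abs_summable_on smooth_tuples k P"
    using summable_on_reindex_bij_betw[OF bij, of "\<lambda>n. norm (mult_ext k g n)"] by simp
  have "infsum (mult_ext k g) (smooth_tuples k P) = infsum (\<lambda>w. mult_ext k g (prime_powers_tuple k P w)) (PiE P (\<lambda>_. exponent_tuples k))"
    by (rule infsum_reindex_bij_betw[OF bij, symmetric])
  also have "\<dots> = infsum (\<lambda>w. \<Prod>p\<in>P. g p (w p)) (PiE P (\<lambda>_. exponent_tuples k))"
    by (rule infsum_cong) (rule eq)
  also have "\<dots> = (\<Prod>p\<in>P. infsum (g p) (exponent_tuples k))"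
    using assms by (intro infsum_prod_PiE_abs) auto
  finally show "infsum (mult_ext k g) (smooth_tuples k P) = (\<Prod>p\<in>P. infsum (g p) (exponent_tuples k))" .
qed

lemma norm_mult_ext:
  fixes g :: "nat \<Rightarrow> (nat \<Rightarrow> nat) \<Rightarrow> 'a::real_normed_field"
  shows "norm (mult_ext k g n) = mult_ext k (\<lambda>p v. norm (g p v)) n"
  by (simp add: mult_ext_def prod_norm)

text \<open>All but \<open>e / 2\<close> of the absolute sum sits on a finite \<open>X\<close>; as
  soon as \<open>S N\<close> contains \<open>X\<close>, the omitted part has absolute mass at most
  \<open>e / 2\<close>. The sets \<open>S N\<close> may be infinite, as those of the application
  are.\<close>

lemma infsum_exhaustion:
  fixes f :: "'a \<Rightarrow> 'b::banach"
  assumes "f abs_summable_on A" "\<And>N. S N \<subseteq> A"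
    "\<And>x. x \<in> A \<Longrightarrow> eventually (\<lambda>N. x \<in> S N) F"
  shows "((\<lambda>N. infsum f (S N)) \<longlongrightarrow> infsum f A) F"
proof (rule tendstoI)
  fix e :: real assume e: "e > 0"
  obtain X where X: "finite X" "X \<subseteq> A" "dist (sum (\<lambda>x. norm (f x)) X) (infsum (\<lambda>x. norm (f x)) A) \<le> e / 2"
    using infsum_finite_approximation[OF assms(1), of "e/2"] e by auto
  have "eventually (\<lambda>N. \<forall>x\<in>X. x \<in> S N) F"
    using X assms(3) by (intro eventually_ball_finite) auto
  then show "eventually (\<lambda>N. dist (infsum f (S N)) (infsum f A) < e) F"
  proof eventually_elim
    fix N assume N: "\<forall>x\<in>X. x \<in> S N"
    have sm: "f summable_on B" "(\<lambda>x. norm (f x)) summable_on B" if "B \<subseteq> A" for B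
      using assms(1) that abs_summable_summable summable_on_subset_banach by blast+
    have "dist (infsum f (S N)) (infsum f A) = norm (infsum f (A - S N))"
      using assms sm by (subst infsum_Diff) (auto simp: dist_norm norm_minus_commute)
    also have "\<dots> \<le> infsum (\<lambda>x. norm (f x)) (A - S N)"
      by (intro norm_infsum_bound sm) auto
    also have "\<dots> \<le> infsum (\<lambda>x. norm (f x)) (A - X)"
      using N by (intro infsum_mono_neutral sm) auto
    also have "\<dots> = infsum (\<lambda>x. norm (f x)) A - sum (\<lambda>x. norm (f x)) X"
      using X sm by (subst infsum_Diff) auto
    also have "\<dots> \<le> e / 2"
      using X(3) unfolding dist_real_def by linarith
    finally show "dist (infsum f (S N)) (infsum f A) < e" using e by simp
  qed
qed

text \<open>A finite set of tuples involves finitely many primes, so its absolute sum is at most a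
  finite product of local sums. Since \<open>1 + c p \<le> exp (c p)\<close>, the number
  \<open>exp (suminf c)\<close> bounds all these products at once.\<close>

lemma abs_summable_mult_ext:
  fixes g :: "nat \<Rightarrow> (nat \<Rightarrow> nat) \<Rightarrow> 'a::{banach, real_normed_field}"
  assumes one: "\<And>p. prime p \<Longrightarrow> g p (tzero k) = 1"
    and sm: "\<And>p. prime p \<Longrightarrow> g p abs_summable_on exponent_tuples k"
    and bd: "\<And>p. prime p \<Longrightarrow> infsum (\<lambda>v. norm (g p v)) (exponent_tuples k) \<le> 1 + c p"
    and c: "summable c" "\<And>p. 0 \<le> c p"
  shows "mult_ext k g abs_summable_on tuples k"
proof (rule nonneg_bdd_above_summable_on)
  show "bdd_above (sum (\<lambda>n. norm (mult_ext k g n)) ` {F. F \<subseteq> tuples k \<and> finite F})"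
  proof (rule bdd_aboveI2)
    fix F assume F: "F \<in> {F. F \<subseteq> tuples k \<and> finite F}"
    define P where "P = (\<Union>n\<in>F. tprimes k n)"
    have P: "finite P" "\<And>p. p \<in> P \<Longrightarrow> prime p"
      using F by (auto simp: P_def finite_tprimes tprimes_prime)
    have sub: "F \<subseteq> smooth_tuples k P"
      using F by (auto simp: P_def smooth_tuples_def)
    have sm': "mult_ext k (\<lambda>p v. norm (g p v)) summable_on smooth_tuples k P"
      using abs_summable_mult_ext_smooth[OF P, where g = g and k = k] one sm
      by (simp add: norm_mult_ext)
    have "(\<Sum>n\<in>F. norm (mult_ext k g n)) = (\<Sum>n\<in>F. mult_ext k (\<lambda>p v. norm (g p v)) n)"
      by (simp add: norm_mult_ext)
    also have "\<dots> \<le> infsum (mult_ext k (\<lambda>p v. norm (g p v))) (smooth_tuples k P)"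
      using F sub by (intro finite_sum_le_infsum[OF sm']) (auto simp: mult_ext_def intro!: prod_nonneg)
    also have "\<dots> = (\<Prod>p\<in>P. infsum (\<lambda>v. norm (g p v)) (exponent_tuples k))"
      using P one sm by (intro infsum_mult_ext_smooth) auto
    also have "\<dots> \<le> (\<Prod>p\<in>P. exp (c p))"
    proof (intro prod_mono conjI infsum_nonneg)
      fix p assume "p \<in> P"
      then show "infsum (\<lambda>v. norm (g p v)) (exponent_tuples k) \<le> exp (c p)"
        using bd[of p] P(2)[of p] exp_ge_add_one_self[of "c p"] by linarith
    qed auto
    also have "\<dots> = exp (\<Sum>p\<in>P. c p)" using P by (simp add: exp_sum)
    also have "\<dots> \<le> exp (suminf c)" using c P by (simp add: sum_le_suminf)
    finally show "(\<Sum>n\<in>F. norm (mult_ext k g n)) \<le> exp (suminf c)" .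
  qed
qed auto

text \<open>The partial product up to \<open>N\<close> is the sum over the tuples whose primes are
  at most \<open>N\<close>, and these sets exhaust all tuples. Only the limit is identified here;
  \<open>convergent_prod\<close> is a stronger property and is derived separately.\<close>

lemma euler_product_tendsto:
  fixes g :: "nat \<Rightarrow> (nat \<Rightarrow> nat) \<Rightarrow> 'a::{banach, real_normed_field}"
  assumes one: "\<And>p. prime p \<Longrightarrow> g p (tzero k) = 1"
    and sm: "\<And>p. prime p \<Longrightarrow> g p abs_summable_on exponent_tuples k"
    and abs: "mult_ext k g abs_summable_on tuples k"
  shows "(\<lambda>N. \<Prod>p\<le>N. if prime p then infsum (g p) (exponent_tuples k) else 1)
           \<longlonglongrightarrow> infsum (mult_ext k g) (tuples k)"
proof -
  have "(\<Prod>p\<le>N. if prime p then infsum (g p) (exponent_tuples k) else 1)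
      = infsum (mult_ext k g) (smooth_tuples k {p. p \<le> N \<and> prime p})" for N
  proof -
    have "(\<Prod>p\<le>N. if prime p then infsum (g p) (exponent_tuples k) else 1)
      = (\<Prod>p\<in>{p. p \<le> N \<and> prime p}. infsum (g p) (exponent_tuples k))"
      by (intro prod.mono_neutral_cong_right) auto
    also have "\<dots> = infsum (mult_ext k g) (smooth_tuples k {p. p \<le> N \<and> prime p})"
      using one sm by (intro infsum_mult_ext_smooth[symmetric]) auto
    finally show ?thesis .
  qed
  moreover have "(\<lambda>N. infsum (mult_ext k g) (smooth_tuples k {p. p \<le> N \<and> prime p}))
       \<longlonglongrightarrow> infsum (mult_ext k g) (tuples k)"
  proof (rule infsum_exhaustion[OF abs])
    fix n assume n: "n \<in> tuples k"
    obtain M where M: "\<forall>p\<in>tprimes k n. p \<le> M"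
      using finite_tprimes[OF n] finite_nat_set_iff_bounded_le by auto
    show "\<forall>\<^sub>F N in sequentially. n \<in> smooth_tuples k {p. p \<le> N \<and> prime p}"
      using eventually_ge_at_top[of M]
      by eventually_elim (use M n in \<open>auto simp: smooth_tuples_def tprimes_prime intro: order_trans\<close>)
  qed (auto simp: smooth_tuples_def)
  ultimately show ?thesis by simp
qed

text \<open>A divisor tuple amounts to a choice, at each prime of \<open>n\<close>, of exponents not
  exceeding those of \<open>n\<close>. The choices at different primes are independent, so the
  divisor sum is again multiplicative.\<close>

lemma sum_dvd_mult_ext:
  fixes h :: "nat \<Rightarrow> (nat \<Rightarrow> nat) \<Rightarrow> 'a::comm_semiring_1"
  assumes n: "n \<in> tuples k" and one: "\<And>p. prime p \<Longrightarrow> h p (tzero k) = 1"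
  shows "(\<Sum>d\<in>PiE {..<k} (\<lambda>i. {d. d dvd n i}). mult_ext k h d)
       = mult_ext k (\<lambda>p v. \<Sum>w\<in>PiE {..<k} (\<lambda>i. {..v i}). h p w) n"
proof -
  define P where "P = tprimes k n"
  have P: "finite P" "\<And>p. p \<in> P \<Longrightarrow> prime p"
    using n by (auto simp: P_def finite_tprimes tprimes_prime)
  define W where "W = PiE P (\<lambda>p. PiE {..<k} (\<lambda>i. {..tmult k p n i}))"
  have W: "w \<in> W \<longleftrightarrow> w \<in> PiE P (\<lambda>_. exponent_tuples k) \<and> (\<forall>p\<in>P. \<forall>i<k. w p i \<le> multiplicity p (n i))" for w
    by (auto simp: W_def PiE_iff exponent_tuples_def tmult_def)
  define D where "D = PiE {..<k} (\<lambda>i. {d. d dvd n i})"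
  have pos: "n i > 0" if "i < k" for i using n that by (auto simp: tuples_def PiE_iff)
  have D: "D = {d \<in> smooth_tuples k P. \<forall>i<k. d i dvd n i}"
  proof -
    have "d \<in> smooth_tuples k P" if d: "d \<in> D" for d
    proof -
      have dv: "d i dvd n i" if "i < k" for i using d that by (auto simp: D_def PiE_iff)
      have "d i > 0" if "i < k" for i using dv pos that dvd_pos_nat by blast
      then have "d \<in> tuples k" using d by (auto simp: D_def tuples_def PiE_iff)
      moreover have "tprimes k d \<subseteq> P"
        using dv dvd_trans unfolding P_def tprimes_def by blast
      ultimately show ?thesis by (simp add: smooth_tuples_def)
    qed
    moreover have "d \<in> D" if "d \<in> smooth_tuples k P" "\<forall>i<k. d i dvd n i" for d
      using that unfolding D_def smooth_tuples_def tuples_def PiE_iff by blast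
    moreover have "d i dvd n i" if "d \<in> D" "i < k" for d i
      using that by (auto simp: D_def PiE_iff)
    ultimately show ?thesis by blast
  qed
  note bij = bij_betw_prime_powers_tuple[OF P, of k]
  \<comment> \<open>Divisibility is compared prime by prime, which cuts the bijection for all smooth
    tuples down to the divisors of \<open>n\<close>.\<close>
  have inW: "prime_powers_tuple k P w \<in> D \<longleftrightarrow> w \<in> W" if w: "w \<in> PiE P (\<lambda>_. exponent_tuples k)" for w
  proof -
    have sm: "prime_powers_tuple k P w \<in> smooth_tuples k P" using bij w by (auto dest: bij_betwE)
    have eq: "n i = (\<Prod>p\<in>P. p ^ multiplicity p (n i))" if "i < k" for i
      using tuple_component_eq[OF smooth_tuples_tprimes[OF n] _ _ that] P by (simp add: P_def)
    have "(\<Prod>p\<in>P. p ^ w p i) dvd n i \<longleftrightarrow> (\<forall>p\<in>P. w p i \<le> multiplicity p (n i))" if i: "i < k" for i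
    proof
      assume "(\<Prod>p\<in>P. p ^ w p i) dvd n i"
      then have "multiplicity p (\<Prod>p\<in>P. p ^ w p i) \<le> multiplicity p (n i)" for p
        using pos[OF i] by (intro dvd_imp_multiplicity_le) auto
      then show "\<forall>p\<in>P. w p i \<le> multiplicity p (n i)"
        using multiplicity_prod_prime_powers[OF P, of _ "\<lambda>p. w p i"] P(2) by metis
    next
      assume "\<forall>p\<in>P. w p i \<le> multiplicity p (n i)"
      then show "(\<Prod>p\<in>P. p ^ w p i) dvd n i"
        by (subst eq[OF i]) (intro prod_dvd_prod le_imp_power_dvd, auto)
    qed
    then show ?thesis using sm w by (auto simp: D W prime_powers_tuple_def)
  qed
  have "bij_betw (prime_powers_tuple k P) W D"
  proof (rule bij_betw_subset[OF bij])
    show sub: "W \<subseteq> PiE P (\<lambda>_. exponent_tuples k)" using W by blast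
    then have "W = {w \<in> PiE P (\<lambda>_. exponent_tuples k). prime_powers_tuple k P w \<in> D}"
      using inW by blast
    moreover have "D \<subseteq> prime_powers_tuple k P ` PiE P (\<lambda>_. exponent_tuples k)"
      using bij unfolding D bij_betw_def by blast
    ultimately show "prime_powers_tuple k P ` W = D"
      by auto
  qed
  then have "(\<Sum>d\<in>D. mult_ext k h d) = (\<Sum>w\<in>W. mult_ext k h (prime_powers_tuple k P w))"
    by (rule sum.reindex_bij_betw[symmetric])
  also have "\<dots> = (\<Sum>w\<in>W. \<Prod>p\<in>P. h p (w p))"
  proof (rule sum.cong[OF refl])
    fix w assume "w \<in> W"
    then have w: "w \<in> PiE P (\<lambda>_. exponent_tuples k)" by (simp add: W)
    then have "prime_powers_tuple k P w \<in> smooth_tuples k P" using bij by (auto dest: bij_betwE)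
    then show "mult_ext k h (prime_powers_tuple k P w) = (\<Prod>p\<in>P. h p (w p))"
      using mult_ext_smooth[where g = h] P one w
      by (simp add: tmult_prime_powers_tuple PiE_iff)
  qed
  also have "\<dots> = (\<Prod>p\<in>P. \<Sum>w\<in>PiE {..<k} (\<lambda>i. {..tmult k p n i}). h p w)"
    unfolding W_def by (rule prod_sum_PiE[symmetric]) (auto intro!: P finite_PiE)
  finally show ?thesis by (simp add: D_def mult_ext_def P_def)
qed

section \<open>Differences in several variables\<close>

definition tshift :: "nat \<Rightarrow> nat set \<Rightarrow> (nat \<Rightarrow> nat) \<Rightarrow> nat \<Rightarrow> nat" where
  "tshift k J u = (\<lambda>i\<in>{..<k}. if i \<in> J then u i + 1 else u i)"

text \<open>The truncated subtraction never truncates in use: \<open>tunshift\<close> is applied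
  only where \<open>w\<close> is at least 1 on \<open>J\<close>.\<close>

definition tunshift :: "nat \<Rightarrow> nat set \<Rightarrow> (nat \<Rightarrow> nat) \<Rightarrow> nat \<Rightarrow> nat" where
  "tunshift k J w = (\<lambda>i\<in>{..<k}. if i \<in> J then w i - 1 else w i)"

text \<open>The backward difference taken once in every variable, expanded over the set
  \<open>J\<close> of the variables that are shifted. The condition on \<open>J\<close> amounts to
  extending \<open>a\<close> by 0 to negative exponents. Over all primes this is Dirichlet
  convolution with the Moebius function in each variable.\<close>

definition tdiff :: "nat \<Rightarrow> ((nat \<Rightarrow> nat) \<Rightarrow> 'a) \<Rightarrow> (nat \<Rightarrow> nat) \<Rightarrow> 'a::comm_ring_1" where
  "tdiff k a w = (\<Sum>J | J \<in> Pow {..<k} \<and> (\<forall>j\<in>J. 1 \<le> w j). (-1) ^ card J * a (tunshift k J w))"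

lemma finite_Pow_filter [simp]: "finite {J. J \<in> Pow {..<k::nat} \<and> Q J}"
  by (rule finite_subset[of _ "Pow {..<k}"]) auto

lemma bij_betw_tshift:
  assumes "J \<subseteq> {..<k}"
  shows "bij_betw (tshift k J) (exponent_tuples k) {w \<in> exponent_tuples k. \<forall>j\<in>J. 1 \<le> w j}"
proof (rule bij_betwI[where g = "tunshift k J"])
  show "tshift k J \<in> exponent_tuples k \<rightarrow> {w \<in> exponent_tuples k. \<forall>j\<in>J. 1 \<le> w j}"
    using assms by (auto simp: tshift_def exponent_tuples_def)
  show "tunshift k J \<in> {w \<in> exponent_tuples k. \<forall>j\<in>J. 1 \<le> w j} \<rightarrow> exponent_tuples k"
    by (auto simp: tunshift_def exponent_tuples_def)
  show "tunshift k J (tshift k J u) = u" if "u \<in> exponent_tuples k" for u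
    using that by (auto simp: tshift_def tunshift_def exponent_tuples_def fun_eq_iff PiE_iff extensional_def)
  show "tshift k J (tunshift k J w) = w" if "w \<in> {w \<in> exponent_tuples k. \<forall>j\<in>J. 1 \<le> w j}" for w
    using that by (auto simp: tshift_def tunshift_def exponent_tuples_def fun_eq_iff PiE_iff extensional_def)
qed

lemma tunshift_tshift: "u \<in> exponent_tuples k \<Longrightarrow> tunshift k J (tshift k J u) = u"
  by (auto simp: tshift_def tunshift_def exponent_tuples_def fun_eq_iff PiE_iff extensional_def)

lemma tdeg_tshift:
  assumes "J \<subseteq> {..<k}"
  shows "tdeg k (tshift k J u) = tdeg k u + card J"
proof -
  have "tdeg k (tshift k J u) = (\<Sum>i<k. u i + (if i \<in> J then 1 else 0))"
    by (auto simp: tdeg_def tshift_def intro!: sum.cong)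
  also have "\<dots> = tdeg k u + card ({..<k} \<inter> J)"
    by (simp add: sum.distrib tdeg_def sum.If_cases)
  also have "{..<k} \<inter> J = J" using assms by auto
  finally show ?thesis .
qed

lemma sum_Pow_power_card:
  fixes z :: "'a::comm_ring_1"
  assumes "finite D"
  shows "(\<Sum>J\<in>Pow D. z ^ card J) = (1 + z) ^ card D"
  using prod_add[OF assms, of "\<lambda>_. z" "\<lambda>_. 1"] by (simp add: add.commute)

text \<open>Local Moebius inversion. After the order of summation is exchanged, the coefficient of
  \<open>a u\<close> is an alternating sum over the subsets of the coordinates in which
  \<open>u\<close> lies strictly below \<open>v\<close>; it vanishes unless there are none.\<close>

lemma sum_tdiff:
  fixes a :: "(nat \<Rightarrow> nat) \<Rightarrow> 'a::comm_ring_1"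
  assumes v: "v \<in> exponent_tuples k"
  shows "(\<Sum>w\<in>PiE {..<k} (\<lambda>i. {..v i}). tdiff k a w) = a v"
proof -
  define V where "V = PiE {..<k} (\<lambda>i. {..v i})"
  have V: "w \<in> V \<longleftrightarrow> w \<in> exponent_tuples k \<and> (\<forall>i<k. w i \<le> v i)" for w
    by (auto simp: V_def exponent_tuples_def PiE_iff)
  have fin: "finite V" by (auto simp: V_def intro!: finite_PiE)
  have "(\<Sum>w\<in>V. tdiff k a w)
    = (\<Sum>J\<in>Pow {..<k}. \<Sum>w | w \<in> V \<and> (\<forall>j\<in>J. 1 \<le> w j). (-1) ^ card J * a (tunshift k J w))"
    unfolding tdiff_def using fin by (rule sum.swap_restrict) auto
  also have "\<dots> = (\<Sum>J\<in>Pow {..<k}. \<Sum>u | u \<in> V \<and> (\<forall>j\<in>J. u j < v j). (-1) ^ card J * a u)"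
  proof (rule sum.cong[OF refl])
    fix J assume J: "J \<in> Pow {..<k}"
    \<comment> \<open>On the coordinates of \<open>J\<close>, the range
      \<open>1 \<le> w j \<le> v j\<close> becomes \<open>u j < v j\<close>, the form in which the
      possible \<open>J\<close> are the subsets of a set depending only on \<open>u\<close>.\<close>
    have "bij_betw (tshift k J) {u \<in> V. \<forall>j\<in>J. u j < v j} {w \<in> V. \<forall>j\<in>J. 1 \<le> w j}"
    proof (rule bij_betw_subset[OF bij_betw_tshift])
      show "tshift k J ` {u \<in> V. \<forall>j\<in>J. u j < v j} = {w \<in> V. \<forall>j\<in>J. 1 \<le> w j}" (is "?l = ?r")
      proof
        show "?l \<subseteq> ?r" using J by (auto simp: V tshift_def exponent_tuples_def Suc_le_eq)
        show "?r \<subseteq> ?l"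
        proof
          fix w assume w: "w \<in> ?r"
          have "w = tshift k J (tunshift k J w)"
            using w by (auto simp: V tshift_def tunshift_def exponent_tuples_def fun_eq_iff PiE_iff extensional_def)
          moreover have "tunshift k J w i \<le> v i" if "i < k" for i
            using w that by (auto simp: V tunshift_def intro: le_trans[OF diff_le_self])
          moreover have "tunshift k J w j < v j" if "j \<in> J" for j
          proof -
            have "j < k" "1 \<le> w j" "w j \<le> v j" using that w J by (auto simp: V)
            then show ?thesis using that by (simp add: tunshift_def)
          qed
          moreover have "tunshift k J w \<in> exponent_tuples k"
            by (simp add: tunshift_def exponent_tuples_def)
          ultimately show "w \<in> ?l" unfolding image_iff V by blast
        qed
      qed
    qed (use J in \<open>auto simp: V\<close>)
    from sum.reindex_bij_betw[OF this, of "\<lambda>w. (-1) ^ card J * a (tunshift k J w)", symmetric]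
    show "(\<Sum>w | w \<in> V \<and> (\<forall>j\<in>J. 1 \<le> w j). (-1) ^ card J * a (tunshift k J w))
        = (\<Sum>u | u \<in> V \<and> (\<forall>j\<in>J. u j < v j). (-1) ^ card J * a u)"
      by (simp add: tunshift_tshift V cong: sum.cong_simp)
  qed
  also have "\<dots> = (\<Sum>u\<in>V. \<Sum>J | J \<in> Pow {..<k} \<and> (\<forall>j\<in>J. u j < v j). (-1) ^ card J * a u)"
    using fin by (intro sum.swap_restrict[symmetric]) auto
  also have "\<dots> = (\<Sum>u\<in>V. if u = v then a v else 0)"
  proof (rule sum.cong[OF refl])
    fix u assume u: "u \<in> V"
    define D where "D = {i. i < k \<and> u i < v i}"
    have "(\<Sum>J | J \<in> Pow {..<k} \<and> (\<forall>j\<in>J. u j < v j). (-1) ^ card J * a u)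
        = (\<Sum>J\<in>Pow D. (-1) ^ card J) * a u"
      unfolding sum_distrib_right by (rule sum.cong) (auto simp: D_def)
    also have "\<dots> = (1 + -1) ^ card D * a u"
      by (subst sum_Pow_power_card) (auto simp: D_def)
    also have "D = {} \<longleftrightarrow> u = v"
    proof
      assume "D = {}"
      then have "u i = v i" if "i < k" for i
        using that u by (force simp: D_def V intro: antisym)
      then show "u = v"
        using u v by (intro PiE_ext[of u "{..<k}" _ v]) (auto simp: V exponent_tuples_def)
    qed (simp add: D_def)
    then have "(1 + -1) ^ card D * a u = (if u = v then a v else 0)"
      by (auto simp: D_def power_0_left)
    finally show "(\<Sum>J | J \<in> Pow {..<k} \<and> (\<forall>j\<in>J. u j < v j). (-1) ^ card J * a u)
        = (if u = v then a v else 0)" .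
  qed
  also have "\<dots> = a v" using fin v by (simp add: V)
  finally show ?thesis by (simp add: V_def)
qed

lemma has_sum_sum:
  fixes f :: "'i \<Rightarrow> 'a \<Rightarrow> 'b::topological_comm_monoid_add"
  assumes "\<And>i. i \<in> I \<Longrightarrow> (f i has_sum s i) A"
  shows "((\<lambda>x. \<Sum>i\<in>I. f i x) has_sum (\<Sum>i\<in>I. s i)) A"
  using assms by (induction I rule: infinite_finite_induct) (auto intro!: has_sum_add)

text \<open>In the generating series, shifting by \<open>J\<close> multiplies by
  \<open>z ^ card J\<close>, so the difference in each variable contributes one factor
  \<open>1 - z\<close>. With \<open>z = 1 / p\<close> this produces the factor
  \<open>(1 - 1 / p) ^ k\<close> of the Euler product.\<close>

lemma infsum_tdiff:
  fixes a :: "(nat \<Rightarrow> nat) \<Rightarrow> 'a::{banach, real_normed_field}"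
  assumes "(\<lambda>v. a v * z ^ tdeg k v) abs_summable_on exponent_tuples k"
  shows "infsum (\<lambda>w. tdiff k a w * z ^ tdeg k w) (exponent_tuples k)
       = (1 - z) ^ k * infsum (\<lambda>v. a v * z ^ tdeg k v) (exponent_tuples k)"
proof -
  define E where "E = exponent_tuples k"
  \<comment> \<open>Extension by zero gives the terms for all \<open>J\<close> the same index set,
    so that finitely many infinite sums can be added.\<close>
  define t where "t = (\<lambda>J w. if \<forall>j\<in>J. 1 \<le> w j then (-1) ^ card J * a (tunshift k J w) * z ^ tdeg k w else 0)"
  have sm: "(\<lambda>v. a v * z ^ tdeg k v) summable_on E"
    using assms by (auto intro: abs_summable_summable simp: E_def)
  have t: "(t J has_sum (-z) ^ card J * infsum (\<lambda>v. a v * z ^ tdeg k v) E) E" if J: "J \<in> Pow {..<k}" for J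
  proof -
    have "((\<lambda>v. (-z) ^ card J * (a v * z ^ tdeg k v)) has_sum (-z) ^ card J * infsum (\<lambda>v. a v * z ^ tdeg k v) E) E"
      using sm by (intro has_sum_cmult_right) simp
    also have "?this \<longleftrightarrow> ((\<lambda>u. t J (tshift k J u)) has_sum (-z) ^ card J * infsum (\<lambda>v. a v * z ^ tdeg k v) E) E"
    proof (rule has_sum_cong)
      fix u assume "u \<in> E"
      then show "(-z) ^ card J * (a u * z ^ tdeg k u) = t J (tshift k J u)"
        using J power_mult_distrib[of "-1" z "card J"]
        by (auto simp: t_def tunshift_tshift E_def tdeg_tshift power_add) (auto simp: tshift_def)
    qed
    also have "\<dots> \<longleftrightarrow> (t J has_sum (-z) ^ card J * infsum (\<lambda>v. a v * z ^ tdeg k v) E) {w \<in> E. \<forall>j\<in>J. 1 \<le> w j}"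
      unfolding E_def using J by (intro has_sum_reindex_bij_betw bij_betw_tshift) auto
    also have "\<dots> \<longleftrightarrow> (t J has_sum (-z) ^ card J * infsum (\<lambda>v. a v * z ^ tdeg k v) E) E"
      by (rule has_sum_cong_neutral) (auto simp: t_def)
    finally show ?thesis .
  qed
  have "((\<lambda>w. \<Sum>J\<in>Pow {..<k}. t J w) has_sum (\<Sum>J\<in>Pow {..<k}. (-z) ^ card J * infsum (\<lambda>v. a v * z ^ tdeg k v) E)) E"
    by (intro has_sum_sum t)
  also have "(\<Sum>J\<in>Pow {..<k}. (-z) ^ card J * infsum (\<lambda>v. a v * z ^ tdeg k v) E)
      = (1 - z) ^ k * infsum (\<lambda>v. a v * z ^ tdeg k v) E"
    by (simp flip: sum_distrib_right add: sum_Pow_power_card)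
  also have "(\<lambda>w. \<Sum>J\<in>Pow {..<k}. t J w) = (\<lambda>w. tdiff k a w * z ^ tdeg k w)"
    by (auto simp: tdiff_def t_def sum_distrib_right fun_eq_iff split: if_splits intro!: sum.mono_neutral_cong_right)
  finally show ?thesis by (simp add: E_def infsumI)
qed

section \<open>The generalized lcm\<close>

definition lcm_exponent :: "nat \<Rightarrow> nat \<Rightarrow> (nat \<Rightarrow> nat) \<Rightarrow> nat" where
  "lcm_exponent b k v = nat \<lceil>real (Max (v ` {..<k})) / real b\<rceil>"

text \<open>The exponent is the lower adjoint of multiplication by \<open>b\<close>. This form
  replaces the ceiling and the maximum in all arguments about its size.\<close>

lemma lcm_exponent_le_iff:
  assumes "1 \<le> b" "1 \<le> k"
  shows "lcm_exponent b k v \<le> q \<longleftrightarrow> (\<forall>i<k. v i \<le> b * q)"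
proof -
  have "lcm_exponent b k v \<le> q \<longleftrightarrow> real (Max (v ` {..<k})) \<le> real (b * q)"
    using assms by (simp add: lcm_exponent_def nat_le_iff ceiling_le_iff divide_le_eq mult.commute)
  also have "\<dots> \<longleftrightarrow> (\<forall>i<k. v i \<le> b * q)"
    unfolding of_nat_le_iff using assms by (subst Max_le_iff) (auto simp: lessThan_empty_iff)
  finally show ?thesis .
qed

text \<open>Admissibility of \<open>d\<close> is a lower bound on its multiplicity at each prime,
  and \<open>L\<close> attains these bounds exactly. So \<open>L\<close> is admissible and divides
  every admissible \<open>d\<close>; minimality for the order follows from minimality for
  divisibility.\<close>

lemma gen_lcm_eq:
  assumes "1 \<le> b" "1 \<le> k" and n: "n \<in> tuples k"
  shows "gen_lcm b k n = (\<Prod>p\<in>tprimes k n. p ^ lcm_exponent b k (tmult k p n))"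
proof -
  define e where "e = (\<lambda>p. lcm_exponent b k (tmult k p n))"
  define P where "P = tprimes k n"
  have P: "finite P" "\<And>p. p \<in> P \<Longrightarrow> prime p"
    using n by (auto simp: P_def finite_tprimes tprimes_prime)
  have e: "e p \<le> q \<longleftrightarrow> (\<forall>i<k. multiplicity p (n i) \<le> b * q)" for p q
    using lcm_exponent_le_iff[OF assms(1,2)] by (simp add: e_def tmult_def)
  have pos: "n i > 0" if "i < k" for i using n that by (auto simp: tuples_def PiE_iff)
  define L where "L = (\<Prod>p\<in>P. p ^ e p)"
  have Lpos: "L > 0" unfolding L_def using P(2) by (intro prod_pos) (auto simp: prime_gt_0_nat)
  have mL: "multiplicity p L = (if p \<in> P then e p else 0)" if "prime p" for p
    unfolding L_def using multiplicity_prod_prime_powers[OF P that] by auto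
  have pe: "multiplicity p (d ^ b) = b * multiplicity p d" if "prime p" "d > 0" for p d :: nat
    using that by (simp add: prime_elem_multiplicity_power_distrib)
  have "gen_lcm b k n = L"
    unfolding gen_lcm_def
  proof (rule Least_equality)
    have "n i dvd L ^ b" if i: "i < k" for i
    proof (rule multiplicity_le_imp_dvd)
      show "n i \<noteq> 0" using pos[OF i] by simp
      fix p :: nat assume p: "prime p"
      show "multiplicity p (n i) \<le> multiplicity p (L ^ b)"
      proof (cases "p \<in> P")
        case True
        then show ?thesis using e[of p "e p"] i p Lpos by (simp add: pe mL)
      next
        case False
        then show ?thesis using i p by (auto simp: P_def tprimes_def not_dvd_imp_multiplicity_0)
      qed
    qed
    then show "1 \<le> L \<and> (\<forall>i<k. n i dvd L ^ b)" using Lpos by auto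
  next
    fix d assume d: "1 \<le> d \<and> (\<forall>i<k. n i dvd d ^ b)"
    have "L dvd d"
    proof (rule multiplicity_le_imp_dvd)
      fix p :: nat assume p: "prime p"
      have "\<forall>i<k. multiplicity p (n i) \<le> b * multiplicity p d"
        using d p by (auto simp flip: pe intro!: dvd_imp_multiplicity_le)
      then show "multiplicity p L \<le> multiplicity p d"
        using e p by (simp add: mL)
    qed (use Lpos in simp)
    then show "L \<le> d" using d by (intro dvd_imp_le) auto
  qed
  then show ?thesis by (simp add: L_def P_def e_def)
qed

lemma multiplicative_arith_prod:
  assumes f: "multiplicative_arith f" and "finite P" "\<And>p. p \<in> P \<Longrightarrow> prime p"
  shows "f (\<Prod>p\<in>P. p ^ e p) = (\<Prod>p\<in>P. f (p ^ e p))"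
  using assms(2,3)
proof (induction P rule: finite_induct)
  case empty
  then show ?case using f by (simp add: multiplicative_arith_def)
next
  case (insert p P)
  have "coprime (p ^ e p) (\<Prod>q\<in>P. q ^ e q)"
    using insert.hyps(2) insert.prems by (intro prod_coprime_right) (auto intro!: primes_coprime)
  moreover have "0 < p ^ e p" "0 < (\<Prod>q\<in>P. q ^ e q)"
    using insert.prems by (auto simp: prime_gt_0_nat intro!: prod_pos)
  ultimately have "f (p ^ e p * (\<Prod>q\<in>P. q ^ e q)) = f (p ^ e p) * f (\<Prod>q\<in>P. q ^ e q)"
    using f unfolding multiplicative_arith_def by blast
  then show ?case using insert by simp
qed

lemma gen_lcm_mult_ext:
  assumes "multiplicative_arith f" "1 \<le> b" "1 \<le> k" "n \<in> tuples k"
  shows "f (gen_lcm b k n) = mult_ext k (\<lambda>p v. f (p ^ lcm_exponent b k v)) n"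
  unfolding gen_lcm_eq[OF assms(2-4)] mult_ext_def
  using assms by (intro multiplicative_arith_prod) (auto simp: finite_tprimes tprimes_prime)

section \<open>Degrees, lcm exponents and the size of functions in the class\<close>

lemma tdeg_eq_0_iff: "v \<in> exponent_tuples k \<Longrightarrow> tdeg k v = 0 \<longleftrightarrow> v = tzero k"
  by (auto simp: tdeg_def tzero_def exponent_tuples_def PiE_iff extensional_def fun_eq_iff)

lemma tdeg_tzero [simp]: "tdeg k (tzero k) = 0"
  by (simp add: tdeg_def tzero_def)

lemma tzero_exponent_tuples [simp]: "tzero k \<in> exponent_tuples k"
  by (simp add: tzero_def exponent_tuples_def)

text \<open>The growth of \<open>f\<close> at a prime power is governed by \<open>r\<close> times
  this exponent, so the upper bound serves \<open>r \<ge> 0\<close> and the lower bound serves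
  \<open>r < 0\<close>.\<close>

lemma lcm_exponent_bounds:
  assumes "1 \<le> b" "1 \<le> k"
  shows "lcm_exponent b k v \<le> tdeg k v" "tdeg k v \<noteq> 0 \<Longrightarrow> 1 \<le> lcm_exponent b k v"
proof -
  have "v i \<le> b * tdeg k v" if "i < k" for i
  proof -
    have "v i \<le> tdeg k v" unfolding tdeg_def using that by (intro member_le_sum) auto
    also have "\<dots> \<le> b * tdeg k v" using assms by simp
    finally show ?thesis .
  qed
  then show "lcm_exponent b k v \<le> tdeg k v" using assms by (simp add: lcm_exponent_le_iff)
  show "1 \<le> lcm_exponent b k v" if "tdeg k v \<noteq> 0"
    using that lcm_exponent_le_iff[OF assms, of v 0] by (auto simp: tdeg_def Suc_le_eq)
qed

lemma lcm_exponent_tzero: "1 \<le> b \<Longrightarrow> 1 \<le> k \<Longrightarrow> lcm_exponent b k (tzero k) = 0"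
  using lcm_exponent_bounds(1)[of b k "tzero k"] by simp

lemma abs_summable_power_tdeg:
  fixes z :: real
  assumes "0 \<le> z" "z < 1"
  shows "(\<lambda>v. z ^ tdeg k v) abs_summable_on exponent_tuples k"
proof -
  have "(\<lambda>n. z ^ n) abs_summable_on (UNIV :: nat set)"
    using assms by (intro summable_nonneg_imp_summable_on) auto
  then have "(\<lambda>v. \<Prod>i<k. z ^ v i) abs_summable_on (PiE {..<k} (\<lambda>_. UNIV))"
    by (intro abs_summable_prod_PiE) auto
  then show ?thesis by (simp add: tdeg_def power_sum exponent_tuples_def)
qed

lemma class_A_bounds:
  assumes "f \<in> class_A r"
  obtains C where "1 \<le> C" "\<And>p. prime p \<Longrightarrow> cmod (f p - complex_of_real (real p powr r)) \<le> C * real p powr (r - 1/2)"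
    "\<And>p q. prime p \<Longrightarrow> cmod (f (p ^ q)) \<le> C * real p powr (r * real q)"
proof -
  obtain C1 C2 where C1: "\<And>p. prime p \<Longrightarrow> cmod (f p - complex_of_real (real p powr r)) \<le> C1 * real p powr (r - 1/2)"
    and C2: "\<And>p v. prime p \<Longrightarrow> 2 \<le> v \<Longrightarrow> cmod (f (p ^ v)) \<le> C2 * real p powr (real v * r)"
    using assms unfolding class_A_def by blast
  have f1: "f 1 = 1" using assms by (simp add: class_A_def multiplicative_arith_def)
  \<comment> \<open>The absolute values avoid a discussion of signs. The summand 1 covers both
    \<open>f 1 = 1\<close> at exponent 0 and the main term \<open>p powr r\<close> of
    \<open>f p\<close> at exponent 1.\<close>
  define C where "C = \<bar>C1\<bar> + \<bar>C2\<bar> + 1"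
  show ?thesis
  proof (rule that[of C])
    show "1 \<le> C" by (simp add: C_def)
  next
    fix p :: nat assume p: "prime p"
    have "C1 * real p powr (r - 1/2) \<le> C * real p powr (r - 1/2)"
      by (intro mult_right_mono) (auto simp: C_def)
    then show "cmod (f p - complex_of_real (real p powr r)) \<le> C * real p powr (r - 1/2)"
      using C1[OF p] by linarith
  next
    fix p q :: nat assume p: "prime p"
    have p1: "1 \<le> real p" using prime_ge_1_nat[OF p] by simp
    consider "q = 0" | "q = 1" | "2 \<le> q" by linarith
    then show "cmod (f (p ^ q)) \<le> C * real p powr (r * real q)"
    proof cases
      case 1
      then show ?thesis using f1 p1 by (auto simp: C_def)
    next
      case 2
      have "cmod (f p) \<le> cmod (f p - complex_of_real (real p powr r)) + cmod (complex_of_real (real p powr r))"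
        using norm_triangle_ineq[of "f p - complex_of_real (real p powr r)" "complex_of_real (real p powr r)"]
        by simp
      also have "\<dots> \<le> \<bar>C1\<bar> * real p powr r + real p powr r"
      proof (intro add_mono)
        have "C1 * real p powr (r - 1/2) \<le> \<bar>C1\<bar> * real p powr r"
          using p1 by (intro mult_mono powr_mono) auto
        then show "cmod (f p - complex_of_real (real p powr r)) \<le> \<bar>C1\<bar> * real p powr r"
          using C1[OF p] by linarith
      qed auto
      also have "\<dots> \<le> C * real p powr r"
        by (simp add: C_def algebra_simps)
      finally show ?thesis using 2 by simp
    next
      case 3
      have "C2 * real p powr (real q * r) \<le> C * real p powr (real q * r)"
        by (intro mult_right_mono) (auto simp: C_def)
      then show ?thesis using C2[OF p 3] by (simp add: mult.commute)
    qed
  qed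
qed

section \<open>Local estimates\<close>

locale lcm_sum =
  fixes b k :: nat and r :: real and f :: "nat \<Rightarrow> complex"
  assumes b: "2 \<le> b" and k: "1 \<le> k" and r: "-1 < r" and f: "f \<in> class_A r"
begin

definition local_coeff :: "nat \<Rightarrow> (nat \<Rightarrow> nat) \<Rightarrow> complex" where
  "local_coeff p v = f (p ^ lcm_exponent b k v) * of_real (real p powr (- r * real (tdeg k v)))"

definition local_diff :: "nat \<Rightarrow> (nat \<Rightarrow> nat) \<Rightarrow> complex" where
  "local_diff p = tdiff k (local_coeff p)"

text \<open>Choosing the constant once for the whole locale makes it visible that the later bounds
  are uniform in the prime.\<close>

definition coeff_bound :: real where
  "coeff_bound = (SOME C. 1 \<le> C \<and>
     (\<forall>p. prime p \<longrightarrow> cmod (f p - complex_of_real (real p powr r)) \<le> C * real p powr (r - 1/2)) \<and>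
     (\<forall>p q. prime p \<longrightarrow> cmod (f (p ^ q)) \<le> C * real p powr (r * real q)))"

lemma coeff_bound:
  shows "1 \<le> coeff_bound"
    and "prime p \<Longrightarrow> cmod (f p - complex_of_real (real p powr r)) \<le> coeff_bound * real p powr (r - 1/2)"
    and "prime p \<Longrightarrow> cmod (f (p ^ q)) \<le> coeff_bound * real p powr (r * real q)"
proof -
  have "\<exists>C. 1 \<le> C \<and>
     (\<forall>p. prime p \<longrightarrow> cmod (f p - complex_of_real (real p powr r)) \<le> C * real p powr (r - 1/2)) \<and>
     (\<forall>p q. prime p \<longrightarrow> cmod (f (p ^ q)) \<le> C * real p powr (r * real q))"
    using class_A_bounds[OF f] by metis
  from someI_ex[OF this, folded coeff_bound_def]
  show "1 \<le> coeff_bound"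
    and "prime p \<Longrightarrow> cmod (f p - complex_of_real (real p powr r)) \<le> coeff_bound * real p powr (r - 1/2)"
    and "prime p \<Longrightarrow> cmod (f (p ^ q)) \<le> coeff_bound * real p powr (r * real q)"
    by auto
qed

lemma f_1: "f (Suc 0) = 1"
  using f by (simp add: class_A_def multiplicative_arith_def)

lemma mult_f: "multiplicative_arith f"
  using f by (simp add: class_A_def)

lemma local_coeff_tzero: "prime p \<Longrightarrow> local_coeff p (tzero k) = 1"
  using b k f_1 by (auto simp: local_coeff_def lcm_exponent_tzero prime_gt_0_nat)

lemma norm_local_coeff:
  assumes p: "prime p"
  shows "cmod (local_coeff p v) \<le> coeff_bound * real p powr (r * real (lcm_exponent b k v) - r * real (tdeg k v))"
proof -
  have "cmod (local_coeff p v) = cmod (f (p ^ lcm_exponent b k v)) * real p powr (- r * real (tdeg k v))"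
    by (simp add: local_coeff_def norm_mult)
  also have "\<dots> \<le> coeff_bound * real p powr (r * real (lcm_exponent b k v)) * real p powr (- r * real (tdeg k v))"
    using p by (intro mult_right_mono coeff_bound) auto
  also have "\<dots> = coeff_bound * real p powr (r * real (lcm_exponent b k v) - r * real (tdeg k v))"
    by (simp add: powr_diff powr_minus field_simps)
  finally show ?thesis .
qed

lemma power_of_nat_inverse:
  "p > 0 \<Longrightarrow> (1 / complex_of_nat p) ^ n = of_real (real p powr (- real n))"
  by (simp add: powr_minus powr_realpow power_divide field_simps)

lemma local_term_eq:
  assumes "prime p"
  shows "local_term b k r f p v = local_coeff p v * (1 / of_nat p) ^ tdeg k v"
proof -
  have p: "p > 0" using assms by (simp add: prime_gt_0_nat)
  have "local_coeff p v * (1 / of_nat p) ^ tdeg k v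
      = f (p ^ lcm_exponent b k v) * of_real (real p powr (- r * real (tdeg k v)) * real p powr (- real (tdeg k v)))"
    using p by (simp add: local_coeff_def power_of_nat_inverse)
  also have "real p powr (- r * real (tdeg k v)) * real p powr (- real (tdeg k v)) = real p powr (- ((r + 1) * real (tdeg k v)))"
    by (simp add: powr_add[symmetric] algebra_simps)
  finally show ?thesis
    unfolding local_term_def lcm_exponent_def[symmetric] tdeg_def[symmetric]
    by (simp only: powr_minus of_real_inverse divide_inverse)
qed

text \<open>With degree \<open>t\<close> and lcm exponent \<open>l\<close> the term has order at
  most \<open>p powr (r * l - r * t - t)\<close>. Inserting \<open>l \<le> t\<close> for
  \<open>r \<ge> 0\<close> and \<open>l \<ge> 0\<close> for \<open>r < 0\<close> bounds this
  exponent by \<open>- m * t\<close>, and \<open>p \<ge> 2\<close> reduces every prime to the same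
  geometric series.\<close>

lemma abs_summable_local_term:
  assumes p: "prime p"
  shows "local_term b k r f p abs_summable_on exponent_tuples k"
proof (rule Infinite_Sum.abs_summable_on_comparison_test')
  define m where "m = min 1 (r + 1)"
  have m: "m > 0" using r by (simp add: m_def)
  have p2: "real p \<ge> 2" using prime_ge_2_nat[OF p] by simp
  have "2 powr (-m) < (1::real)" using m by (simp add: powr_less_one)
  then show "(\<lambda>v. coeff_bound * (2 powr (-m)) ^ tdeg k v) summable_on exponent_tuples k"
    using abs_summable_power_tdeg[of "2 powr (-m)" k] by (intro summable_on_cmult_right) auto
  show "cmod (local_term b k r f p v) \<le> coeff_bound * (2 powr (-m)) ^ tdeg k v" if "v \<in> exponent_tuples k" for v
  proof -
    define t where "t = real (tdeg k v)"
    define l where "l = real (lcm_exponent b k v)"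
    have l: "0 \<le> l" "l \<le> t" using lcm_exponent_bounds[of b k v] b k by (auto simp: l_def t_def)
    have "cmod (local_term b k r f p v) = cmod (local_coeff p v) * real p powr (- t)"
      using p by (simp add: local_term_eq power_of_nat_inverse prime_gt_0_nat norm_mult t_def)
    also have "\<dots> \<le> coeff_bound * real p powr (r * l - r * t) * real p powr (- t)"
      using norm_local_coeff[OF p, of v] by (intro mult_right_mono) (auto simp: l_def t_def)
    also have "\<dots> = coeff_bound * real p powr (r * l - r * t - t)"
      by (simp add: mult.assoc flip: powr_add)
    also have "r * l - r * t - t \<le> - m * t"
    proof (cases "r \<ge> 0")
      case True
      then have "r * l \<le> r * t" using l by (intro mult_left_mono) auto
      moreover have "m = 1" using True by (simp add: m_def)
      ultimately show ?thesis by simp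
    next
      case False
      then have "r * l \<le> 0" using l by (simp add: mult_nonpos_nonneg)
      moreover have "m = r + 1" using False by (simp add: m_def)
      ultimately show ?thesis by (simp add: algebra_simps)
    qed
    then have "coeff_bound * real p powr (r * l - r * t - t) \<le> coeff_bound * real p powr (- m * t)"
      using p2 coeff_bound(1) by (intro mult_left_mono powr_mono) auto
    also have "\<dots> \<le> coeff_bound * 2 powr (- m * t)"
      using p2 coeff_bound(1) m by (intro mult_left_mono powr_mono2') (auto simp: t_def)
    also have "2 powr (- m * t) = (2 powr (-m)) ^ tdeg k v"
      by (simp add: t_def powr_powr flip: powr_realpow)
    finally show ?thesis .
  qed
qed

lemma local_diff_tzero: "prime p \<Longrightarrow> local_diff p (tzero k) = 1"
proof -
  assume p: "prime p"
  have "{J. J \<in> Pow {..<k} \<and> (\<forall>j\<in>J. 1 \<le> tzero k j)} = {{}}"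
    by (auto simp: tzero_def)
  moreover have "tunshift k {} (tzero k) = tzero k"
    by (auto simp: tunshift_def tzero_def)
  ultimately show ?thesis
    unfolding local_diff_def tdiff_def by (simp add: local_coeff_tzero p)
qed

text \<open>This is where the exponent \<open>min (r + 1) 1 / 2\<close> comes from: for larger \<open>\<delta>\<close> the weighted local
  sums need no longer be \<open>1 + O(p powr (-1 - c))\<close> with \<open>c > 0\<close>.\<close>

lemma norm_local_diff:
  assumes p: "prime p" and e: "0 < e" and d: "\<delta> \<le> min (r + 1) 1 / 2 - e"
    and w: "w \<in> exponent_tuples k" "w \<noteq> tzero k"
  shows "cmod (local_diff p w) * real p powr (- (1 - \<delta>) * real (tdeg k w))
    \<le> 2 ^ k * coeff_bound * real p powr (- 1 - e * real (tdeg k w))"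
proof -
  define t where "t = real (tdeg k w)"
  have p2: "real p \<ge> 2" using prime_ge_2_nat[OF p] by simp
  have C: "1 \<le> coeff_bound" by (rule coeff_bound)
  have "tdeg k w \<noteq> 0" using w by (simp add: tdeg_eq_0_iff)
  then consider "tdeg k w = 1" | "tdeg k w \<ge> 2" by linarith
  then show ?thesis
  proof cases
    case 1
    \<comment> \<open>In degree one \<open>w\<close> is a unit vector, and the only shift besides
      the trivial one leads to the zero tuple, where the coefficient is 1. The difference is
      therefore \<open>f p / p powr r - 1\<close>: here cancellation is used.\<close>
    have "\<exists>i\<in>{..<k}. w i = 1 \<and> (\<forall>j\<in>{..<k}. i \<noteq> j \<longrightarrow> w j = 0)"
      using 1 unfolding tdeg_def by (subst (asm) sum_eq_1_iff) auto
    then obtain i where i: "i < k" "w i = 1" "\<And>j. j < k \<Longrightarrow> j \<noteq> i \<Longrightarrow> w j = 0"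
      by (metis lessThan_iff)
    have "lcm_exponent b k w \<le> 1"
      using b k i by (subst lcm_exponent_le_iff) (auto, metis Suc_leD le0 numeral_2_eq_2)
    then have l: "lcm_exponent b k w = 1"
      using lcm_exponent_bounds(2)[of b k w] b k 1 by simp
    have J: "{J. J \<in> Pow {..<k} \<and> (\<forall>j\<in>J. 1 \<le> w j)} = {{}, {i}}"
    proof -
      have "J \<subseteq> {i}" if "J \<in> Pow {..<k}" "\<forall>j\<in>J. 1 \<le> w j" for J
        using that i(3) by force
      then show ?thesis using i by (auto dest!: subset_singletonD)
    qed
    have "tunshift k {} w = w"
      using w by (auto simp: tunshift_def exponent_tuples_def fun_eq_iff PiE_iff extensional_def)
    moreover have "tunshift k {i} w = tzero k"
      using i by (auto simp: tunshift_def tzero_def fun_eq_iff)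
    ultimately have "local_diff p w = local_coeff p w - 1"
      unfolding local_diff_def tdiff_def J by (simp add: local_coeff_tzero p)
    also have "\<dots> = (f p - of_real (real p powr r)) * of_real (real p powr (- r))"
      using p2 by (simp add: local_coeff_def l 1 powr_minus field_simps)
    finally have "cmod (local_diff p w) = cmod (f p - of_real (real p powr r)) * real p powr (- r)"
      by (simp add: norm_mult)
    also have "\<dots> \<le> coeff_bound * real p powr (r - 1/2) * real p powr (- r)"
      by (intro mult_right_mono coeff_bound p) auto
    also have "\<dots> = coeff_bound * real p powr (- (1/2))"
      by (simp add: mult.assoc flip: powr_add)
    finally have "cmod (local_diff p w) * real p powr (- (1 - \<delta>) * t)
        \<le> coeff_bound * real p powr (- (1/2)) * real p powr (- (1 - \<delta>) * t)"
      by (intro mult_right_mono) auto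
    also have "\<dots> = coeff_bound * real p powr (- (1/2) - (1 - \<delta>))"
      using 1 by (simp add: mult.assoc t_def flip: powr_add)
    also have "\<dots> \<le> (2 ^ k * coeff_bound) * real p powr (- 1 - e * t)"
    proof (intro mult_mono powr_mono)
      \<comment> \<open>The degree-one constraint: it says precisely
        \<open>\<delta> \<le> 1 / 2 - e\<close>.\<close>
      show "- (1/2) - (1 - \<delta>) \<le> - 1 - e * t"
      proof -
        have "t = 1" using 1 by (simp add: t_def)
        moreover have "min (r + 1) 1 / 2 \<le> 1 / 2" by (intro divide_right_mono) auto
        then have "\<delta> \<le> 1 / 2 - e" by (intro order_trans[OF d] diff_right_mono)
        ultimately show ?thesis by simp
      qed
    qed (use p2 C in auto)
    finally show ?thesis by (simp add: t_def)
  next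
    case 2
    then have t2: "t \<ge> 2" by (simp add: t_def)
    let ?S = "{J. J \<in> Pow {..<k} \<and> (\<forall>j\<in>J. 1 \<le> w j)}"
    \<comment> \<open>From degree two on each of the at most \<open>2 ^ k\<close> shifted
      coefficients is estimated separately, without cancellation.\<close>
    have term_le: "cmod (local_coeff p (tunshift k J w)) * real p powr (- (1 - \<delta>) * t)
        \<le> coeff_bound * real p powr (- 1 - e * t)" if J: "J \<in> ?S" for J
    proof -
      define u where "u = tunshift k J w"
      define s where "s = real (tdeg k u)"
      define l where "l = real (lcm_exponent b k u)"
      have st: "s \<le> t"
        unfolding s_def t_def u_def tdeg_def tunshift_def of_nat_le_iff by (intro sum_mono) auto
      have l: "0 \<le> l" "l \<le> s" "s \<noteq> 0 \<Longrightarrow> 1 \<le> l"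
        using lcm_exponent_bounds[of b k u] b k by (auto simp: l_def s_def)
      have s: "0 \<le> s" by (simp add: s_def)
      \<comment> \<open>For \<open>r < 0\<close> the extremal case is \<open>l = 1\<close> and
        \<open>s = t = 2\<close>, where the claim reads
        \<open>\<delta> \<le> (r + 1) / 2 - e\<close>. The case \<open>s = 0\<close> is separate
        because \<open>1 \<le> l\<close> fails at the zero tuple.\<close>
      have "r * l - r * s - (1 - \<delta>) * t \<le> - 1 - e * t"
      proof (cases "r \<ge> 0")
        case True
        then have "r * l \<le> r * s" using l by (intro mult_left_mono) auto
        moreover have "\<delta> * t \<le> (1 / 2 - e) * t"
          using True d t2 by (intro mult_right_mono) auto
        ultimately show ?thesis using t2 by (simp add: algebra_simps)
      next
        case False
        have dt: "\<delta> * t \<le> ((r + 1) / 2 - e) * t"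
          using False d t2 by (intro mult_right_mono) auto
        show ?thesis
        proof (cases "s = 0")
          case True
          have "(r + 1) * t \<le> 1 * t" using False t2 by (intro mult_right_mono) auto
          then have "\<delta> * t \<le> t / 2 - e * t" using dt by (simp add: algebra_simps)
          moreover have "l = 0" using True l by simp
          ultimately show ?thesis using t2 True by (simp add: algebra_simps)
        next
          case s0: False
          have "r * l \<le> r * 1" using False l(3)[OF s0] by (intro mult_left_mono_neg) auto
          moreover have "- r * s \<le> - r * t" using False st by (intro mult_left_mono) auto
          moreover have "(r + 1) * 2 \<le> (r + 1) * t" using r t2 by (intro mult_left_mono) auto
          ultimately show ?thesis using dt by (simp add: algebra_simps)
        qed
      qed
      have "cmod (local_coeff p u) * real p powr (- (1 - \<delta>) * t)
        \<le> coeff_bound * real p powr (r * l - r * s) * real p powr (- (1 - \<delta>) * t)"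
        using norm_local_coeff[OF p, of u] by (intro mult_right_mono) (auto simp: l_def s_def)
      also have "\<dots> = coeff_bound * real p powr (r * l - r * s - (1 - \<delta>) * t)"
        by (simp add: mult.assoc flip: powr_add) (simp add: algebra_simps)
      also have "\<dots> \<le> coeff_bound * real p powr (- 1 - e * t)"
        using p2 C \<open>r * l - r * s - (1 - \<delta>) * t \<le> - 1 - e * t\<close> by (intro mult_left_mono powr_mono) auto
      finally show ?thesis by (simp add: u_def)
    qed
    have "cmod (local_diff p w) \<le> (\<Sum>J\<in>?S. cmod (local_coeff p (tunshift k J w)))"
      unfolding local_diff_def tdiff_def by (rule order_trans[OF norm_sum]) (simp add: norm_mult norm_power)
    then have "cmod (local_diff p w) * real p powr (- (1 - \<delta>) * t)
       \<le> (\<Sum>J\<in>?S. cmod (local_coeff p (tunshift k J w)) * real p powr (- (1 - \<delta>) * t))"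
      by (simp add: mult_right_mono flip: sum_distrib_right)
    also have "\<dots> \<le> (\<Sum>J\<in>?S. coeff_bound * real p powr (- 1 - e * t))"
      by (intro sum_mono term_le)
    also have "\<dots> \<le> (\<Sum>J\<in>Pow {..<k}. coeff_bound * real p powr (- 1 - e * t))"
      using C by (intro sum_mono2) auto
    also have "\<dots> = 2 ^ k * coeff_bound * real p powr (- 1 - e * t)"
      by (simp add: card_Pow)
    finally show ?thesis by (simp add: t_def)
  qed
qed

text \<open>The gain \<open>e * t\<close> in the exponent is split in halves. One half, bounded
  using \<open>p \<ge> 2\<close>, gives a geometric series over the exponent tuples; the other,
  bounded using \<open>t \<ge> 1\<close>, leaves \<open>p powr (- 1 - e / 2)\<close>, which is
  summable over the primes. The constant depends neither on \<open>p\<close> nor on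
  \<delta>.\<close>

lemma local_diff_summable_bound:
  assumes e: "0 < e"
  obtains K where "0 \<le> K"
    "\<And>p \<delta>. prime p \<Longrightarrow> \<delta> \<le> min (r + 1) 1 / 2 - e \<Longrightarrow>
      (\<lambda>w. local_diff p w * of_real (real p powr (- (1 - \<delta>) * real (tdeg k w)))) abs_summable_on exponent_tuples k"
    "\<And>p \<delta>. prime p \<Longrightarrow> \<delta> \<le> min (r + 1) 1 / 2 - e \<Longrightarrow>
      infsum (\<lambda>w. cmod (local_diff p w * of_real (real p powr (- (1 - \<delta>) * real (tdeg k w))))) (exponent_tuples k - {tzero k})
        \<le> K * real p powr (- 1 - e / 2)"
proof -
  define z where "z = 2 powr (- e / 2)"
  have z: "0 \<le> z" "z < 1" using e by (auto simp: z_def powr_less_one)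
  define E where "E = exponent_tuples k - {tzero k}"
  have zs: "(\<lambda>w. z ^ tdeg k w) summable_on E"
    using abs_summable_power_tdeg[OF z, of k] z by (auto intro: summable_on_subset_banach simp: E_def)
  define K where "K = 2 ^ k * coeff_bound * infsum (\<lambda>w. z ^ tdeg k w) E"
  have C: "1 \<le> coeff_bound" by (rule coeff_bound)
  define g where "g = (\<lambda>p \<delta> w. local_diff p w * complex_of_real (real p powr (- (1 - \<delta>) * real (tdeg k w))))"
  have bd: "cmod (g p \<delta> w) \<le> (2 ^ k * coeff_bound * real p powr (- 1 - e / 2)) * z ^ tdeg k w"
    if p: "prime p" and d: "\<delta> \<le> min (r + 1) 1 / 2 - e" and w: "w \<in> E" for p \<delta> w
  proof -
    have p2: "real p \<ge> 2" using prime_ge_2_nat[OF p] by simp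
    define t where "t = real (tdeg k w)"
    have t1: "t \<ge> 1" using w tdeg_eq_0_iff[of w k] by (auto simp: E_def t_def Suc_le_eq)
    have "cmod (g p \<delta> w) \<le> 2 ^ k * coeff_bound * real p powr (- 1 - e * t)"
      using norm_local_diff[OF p e d, of w] w by (simp add: E_def t_def g_def norm_mult)
    also have "real p powr (- 1 - e * t) \<le> real p powr ((- 1 - e / 2) + (- e / 2 * t))"
      using p2 t1 e by (intro powr_mono) (auto simp: field_simps)
    also have "\<dots> = real p powr (- 1 - e / 2) * real p powr (- e / 2 * t)"
      by (rule powr_add)
    also have "\<dots> \<le> real p powr (- 1 - e / 2) * 2 powr (- e / 2 * t)"
      using p2 e t1 by (intro mult_left_mono powr_mono2') auto
    also have "2 powr (- e / 2 * t) = z ^ tdeg k w"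
      by (simp add: z_def t_def powr_powr flip: powr_realpow)
    finally show ?thesis using C by (simp add: mult.assoc mult_left_mono)
  qed
  have smE: "g p \<delta> abs_summable_on E" if p: "prime p" and d: "\<delta> \<le> min (r + 1) 1 / 2 - e" for p \<delta>
    by (rule Infinite_Sum.abs_summable_on_comparison_test'[OF summable_on_cmult_right[OF zs] bd]) (use that in auto)
  show ?thesis
  proof (rule that[of K])
    show "0 \<le> K" using C z by (auto simp: K_def intro!: mult_nonneg_nonneg infsum_nonneg)
  next
    fix p :: nat and \<delta> :: real assume p: "prime p" and d: "\<delta> \<le> min (r + 1) 1 / 2 - e"
    have eq: "exponent_tuples k = insert (tzero k) E" by (auto simp: E_def)
    show "(\<lambda>w. local_diff p w * of_real (real p powr (- (1 - \<delta>) * real (tdeg k w)))) abs_summable_on exponent_tuples k"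
      using smE[OF p d] unfolding eq g_def by (subst summable_on_insert_iff)
    have "infsum (\<lambda>w. cmod (g p \<delta> w)) E \<le> infsum (\<lambda>w. (2 ^ k * coeff_bound * real p powr (- 1 - e / 2)) * z ^ tdeg k w) E"
      by (intro infsum_mono smE p d summable_on_cmult_right zs bd)
    also have "\<dots> = K * real p powr (- 1 - e / 2)"
      by (simp add: infsum_cmult_right' K_def)
    finally show "infsum (\<lambda>w. cmod (local_diff p w * of_real (real p powr (- (1 - \<delta>) * real (tdeg k w))))) (exponent_tuples k - {tzero k})
        \<le> K * real p powr (- 1 - e / 2)" by (simp add: g_def E_def)
  qed
qed

end

section \<open>Power sums\<close>

definition power_sum :: "real \<Rightarrow> real \<Rightarrow> real" where
  "power_sum r y = (\<Sum>m | 1 \<le> m \<and> real m \<le> y. real m powr r)"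

lemma finite_nat_real_le: "finite {m::nat. 1 \<le> m \<and> real m \<le> y}"
  by (rule finite_subset[of _ "{..nat \<lfloor>y\<rfloor>}"]) (auto simp: le_nat_floor)

lemma power_sum_less_1: "y < 1 \<Longrightarrow> power_sum r y = 0"
  by (auto simp: power_sum_def intro!: sum.neutral)

lemma powr_antiderivative_mvt:
  assumes "r \<noteq> -1" "0 < a" "a < (c::real)"
  obtains z where "a < z" "z < c" "c powr (r + 1) / (r + 1) - a powr (r + 1) / (r + 1) = (c - a) * z powr r"
proof -
  have "((\<lambda>t. t powr (r + 1) / (r + 1)) has_real_derivative x powr r) (at x)" if "a \<le> x" "x \<le> c" for x
    using assms that by (auto intro!: derivative_eq_intros)
  from MVT2[OF assms(3) this] show ?thesis using that by blast
qed

text \<open>The error telescopes. A step from \<open>N\<close> to \<open>N + 1\<close> adds at most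
  the distance of \<open>B\<close> from \<open>z powr r\<close> with \<open>z\<close> between the
  two integers; as \<open>1\<close>, \<open>A\<close>, \<open>z powr r\<close>, \<open>B\<close> are
  monotonically ordered, all these distances together stay below the total variation
  \<open>\<bar>N powr r - 1\<bar>\<close>. The other summand is the error at
  \<open>N = 1\<close>.\<close>

lemma power_sum_approx_nat:
  assumes r: "-1 < r" and "1 \<le> N"
  shows "\<bar>(\<Sum>m=1..N. real m powr r) - real N powr (r + 1) / (r + 1)\<bar>
           \<le> \<bar>1 - 1 / (r + 1)\<bar> + \<bar>real N powr r - 1\<bar>"
  using assms(2)
proof (induction N rule: nat_induct_at_least)
  case base
  then show ?case by simp
next
  case (Suc N)
  define A B G where "A = real N powr r" and "B = real (Suc N) powr r"
    and "G = (\<lambda>n. real n powr (r + 1) / (r + 1))"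
  obtain z where z: "real N < z" "z < real (Suc N)" "G (Suc N) - G N = z powr r"
    using powr_antiderivative_mvt[of r "real N" "real (Suc N)"] r Suc by (auto simp: G_def)
  have N1: "1 \<le> real N" using Suc by simp
  have "\<bar>B - z powr r\<bar> + \<bar>A - 1\<bar> \<le> \<bar>B - 1\<bar>"
  proof (cases "r \<ge> 0")
    case True
    then have "1 \<le> A" "A \<le> z powr r" "z powr r \<le> B"
      using z N1 by (auto simp: A_def B_def intro!: powr_mono2 ge_one_powr_ge_zero)
    then show ?thesis by linarith
  next
    case False
    then have "A \<le> 1" "z powr r \<le> A" "B \<le> z powr r"
      using z N1 powr_mono[of r 0 "real N"] by (auto simp: A_def B_def intro!: powr_mono2')
    then show ?thesis by linarith
  qed
  moreover have "\<bar>(\<Sum>m=1..N. real m powr r) - G N\<bar> \<le> \<bar>1 - 1 / (r + 1)\<bar> + \<bar>A - 1\<bar>"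
    using Suc.IH by (simp add: G_def A_def)
  moreover have "(\<Sum>m=1..Suc N. real m powr r) = (\<Sum>m=1..N. real m powr r) + B"
    by (simp add: B_def)
  ultimately have "\<bar>(\<Sum>m=1..Suc N. real m powr r) - G (Suc N)\<bar> \<le> \<bar>1 - 1 / (r + 1)\<bar> + \<bar>B - 1\<bar>"
    using z(3) by linarith
  then show ?case by (simp add: G_def B_def)
qed

text \<open>The estimate is also valid for \<open>y < 1\<close>, where the sum is empty; hence no case distinction
  \<open>d \<le> x\<close> is needed when it is applied to \<open>y = x / d\<close> below.\<close>

lemma power_sum_approx:
  assumes r: "-1 < r" and d: "0 \<le> \<delta>" "\<delta> \<le> min (r + 1) 1"
  obtains K where "0 \<le> K"
    "\<And>y. 0 < y \<Longrightarrow> \<bar>power_sum r y - y powr (r + 1) / (r + 1)\<bar> \<le> K * y powr (r + 1 - \<delta>)"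
proof -
  \<comment> \<open>Of the 3, two account for \<open>\<bar>N powr r - 1\<bar>\<close> and one for
    the passage from the integer \<open>N\<close> to \<open>y\<close>. The additional
    \<open>1 / (r + 1)\<close> in the final constant is for \<open>y < 1\<close>.\<close>
  define K0 where "K0 = \<bar>1 - 1 / (r + 1)\<bar> + 3"
  show ?thesis
  proof (rule that[of "K0 + 1 / (r + 1)"])
    show "0 \<le> K0 + 1 / (r + 1)" using r by (simp add: K0_def)
  next
    fix y :: real assume y: "0 < y"
    \<comment> \<open>For \<open>y \<ge> 1\<close> the error is of order \<open>y powr M\<close>,
      and \<open>M \<le> r + 1 - \<delta>\<close> is a reformulation of the upper bound on
      \<delta>.\<close>
    define M where "M = max r 0"
    have M: "M \<le> r + 1 - \<delta>" using d by (auto simp: M_def)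
    define G where "G = (\<lambda>y. y powr (r + 1) / (r + 1))"
    show "\<bar>power_sum r y - y powr (r + 1) / (r + 1)\<bar> \<le> (K0 + 1 / (r + 1)) * y powr (r + 1 - \<delta>)"
    proof (cases "y < 1")
      case True
      \<comment> \<open>Below 1 a smaller exponent gives a larger power. The sum being empty, the
        main term is the whole error and is absorbed.\<close>
      have "y powr (r + 1) \<le> y powr (r + 1 - \<delta>)"
        using True y d by (intro powr_mono') auto
      then have "y powr (r + 1) / (r + 1) \<le> 1 / (r + 1) * y powr (r + 1 - \<delta>)"
        using r divide_right_mono[of "y powr (r + 1)" "y powr (r + 1 - \<delta>)" "r + 1"] by simp
      moreover have "0 \<le> K0 * y powr (r + 1 - \<delta>)" by (simp add: K0_def)
      moreover have "0 \<le> y powr (r + 1) / (r + 1)" using r by simp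
      ultimately show ?thesis using True r by (simp add: power_sum_less_1 distrib_right)
    next
      case False
      then have y1: "1 \<le> y" by simp
      define N where "N = nat \<lfloor>y\<rfloor>"
      have N: "1 \<le> N" "real N \<le> y" "y < real N + 1"
        using y1 by (auto simp: N_def le_nat_floor of_nat_floor)
      have le: "z powr r \<le> y powr M" if "1 \<le> z" "z \<le> y" for z
      proof -
        have "z powr r \<le> z powr M" using that by (intro powr_mono) (auto simp: M_def)
        also have "\<dots> \<le> y powr M" using that by (intro powr_mono2) (auto simp: M_def)
        finally show ?thesis .
      qed
      have one: "1 \<le> y powr M" using y1 by (intro ge_one_powr_ge_zero) (auto simp: M_def)
      have "{m. 1 \<le> m \<and> real m \<le> y} = {1..N}"
        using y1 by (auto simp: N_def le_nat_floor le_nat_iff le_floor_iff)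
      then have ps: "power_sum r y = (\<Sum>m=1..N. real m powr r)"
        by (simp add: power_sum_def)
      have 1: "\<bar>power_sum r y - G (real N)\<bar> \<le> \<bar>1 - 1 / (r + 1)\<bar> + \<bar>real N powr r - 1\<bar>"
        using power_sum_approx_nat[OF r N(1)] by (simp add: ps G_def)
      have "\<bar>real N powr r - 1\<bar> \<le> real N powr r + 1"
        by (simp add: abs_le_iff)
      also have "\<dots> \<le> 2 * y powr M" using le[of "real N"] N one by simp
      finally have 2: "\<bar>real N powr r - 1\<bar> \<le> 2 * y powr M" .
      have 3: "\<bar>G y - G (real N)\<bar> \<le> y powr M"
      proof (cases "real N = y")
        case False
        then obtain z where z: "real N < z" "z < y" "G y - G (real N) = (y - real N) * z powr r"
          using powr_antiderivative_mvt[of r "real N" y] r N by (auto simp: G_def)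
        have "(y - real N) * z powr r \<le> 1 * y powr M"
          using z N by (intro mult_mono le) auto
        moreover have "0 \<le> (y - real N) * z powr r" using N by simp
        ultimately show ?thesis using z(3) by simp
      qed simp
      have "\<bar>1 - 1 / (r + 1)\<bar> \<le> \<bar>1 - 1 / (r + 1)\<bar> * y powr M"
        using one by (simp add: mult_le_cancel_left1)
      then have "\<bar>power_sum r y - G y\<bar> \<le> K0 * y powr M"
        using 1 2 3 unfolding K0_def distrib_right by linarith
      also have "\<dots> \<le> (K0 + 1 / (r + 1)) * y powr (r + 1 - \<delta>)"
        using M y1 r by (intro mult_mono powr_mono) (auto simp: K0_def)
      finally show ?thesis by (simp add: G_def)
    qed
  qed
qed

text \<open>After division by \<open>s i\<close> all factors have absolute value at most 1, so
  replacing them one at a time costs at most \<eta> for each index.\<close>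

lemma abs_prod_diff_le:
  fixes A G :: "'i \<Rightarrow> real"
  assumes "\<And>i. i \<in> I \<Longrightarrow> 0 < s i" "\<And>i. i \<in> I \<Longrightarrow> \<bar>A i\<bar> \<le> s i" "\<And>i. i \<in> I \<Longrightarrow> \<bar>G i\<bar> \<le> s i"
    "\<And>i. i \<in> I \<Longrightarrow> \<bar>A i - G i\<bar> \<le> \<eta> * s i"
  shows "\<bar>(\<Prod>i\<in>I. A i) - (\<Prod>i\<in>I. G i)\<bar> \<le> real (card I) * \<eta> * (\<Prod>i\<in>I. s i)"
proof -
  have pos: "0 < (\<Prod>i\<in>I. s i)" using assms by (intro prod_pos) auto
  have "\<bar>(\<Prod>i\<in>I. A i) - (\<Prod>i\<in>I. G i)\<bar> / (\<Prod>i\<in>I. s i)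
      = norm ((\<Prod>i\<in>I. A i / s i) - (\<Prod>i\<in>I. G i / s i))"
    using pos by (simp add: prod_dividef diff_divide_distrib[symmetric])
  also have "\<dots> \<le> (\<Sum>i\<in>I. norm (A i / s i - G i / s i))"
  proof (rule norm_prod_diff)
    show "norm (A i / s i) \<le> 1" "norm (G i / s i) \<le> 1" if "i \<in> I" for i
      using assms(1-3)[OF that] by (simp_all add: divide_le_eq)
  qed
  also have "\<dots> \<le> (\<Sum>i\<in>I. \<eta>)"
  proof (rule sum_mono)
    show "norm (A i / s i - G i / s i) \<le> \<eta>" if "i \<in> I" for i
      using assms(1,4)[OF that] by (simp add: diff_divide_distrib[symmetric] divide_le_eq)
  qed
  finally show ?thesis using pos by (simp add: divide_le_eq)
qed

section \<open>Tuples in a box and sums over multiples\<close>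

lemma finite_pos_tuples_upto: "finite (pos_tuples_upto k x)"
  unfolding pos_tuples_upto_def by (intro finite_PiE finite_nat_real_le) auto

lemma pos_tuples_upto_iff:
  "n \<in> pos_tuples_upto k x \<longleftrightarrow> n \<in> tuples k \<and> (\<forall>i<k. real (n i) \<le> x)"
  by (auto simp: pos_tuples_upto_def tuples_def PiE_iff Suc_le_eq)

lemma sum_multiples_powr:
  assumes "0 < d"
  shows "(\<Sum>m | 1 \<le> m \<and> real m \<le> x \<and> d dvd m. real m powr r) = real d powr r * power_sum r (x / real d)"
proof -
  have "bij_betw (\<lambda>j. d * j) {m. 1 \<le> m \<and> real m \<le> x / real d} {m. 1 \<le> m \<and> real m \<le> x \<and> d dvd m}"
    using assms by (intro bij_betwI[where g = "\<lambda>m. m div d"])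
      (auto simp: field_simps Suc_le_eq elim!: dvdE)
  from sum.reindex_bij_betw[OF this, of "\<lambda>m. real m powr r", symmetric]
  show ?thesis by (simp add: power_sum_def powr_mult sum_distrib_left)
qed

section \<open>The asymptotic formula\<close>

context lcm_sum
begin

section \<open>The divisor-sum representation and the exchange of summation\<close>

definition diff_coeff :: "(nat \<Rightarrow> nat) \<Rightarrow> complex" where
  "diff_coeff = mult_ext k local_diff"

lemma prod_powr_tprimes:
  assumes "n \<in> tuples k"
  shows "(\<Prod>i<k. real (n i) powr s) = (\<Prod>p\<in>tprimes k n. real p powr (s * real (tdeg k (tmult k p n))))"
  using assms by (intro prod_powr_smooth smooth_tuples_tprimes finite_tprimes) (auto simp: tprimes_prime)

lemma mult_ext_weighted:
  assumes "n \<in> tuples k"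
  shows "mult_ext k (\<lambda>p v. g p v * complex_of_real (real p powr (s * real (tdeg k v)))) n
      = mult_ext k g n * of_real (\<Prod>i<k. real (n i) powr s)"
  by (simp add: mult_ext_def prod.distrib prod_powr_tprimes[OF assms])

text \<open>Moebius inversion, assembled from the primes: summing \<open>local_diff\<close> over
  boxes recovers \<open>local_coeff\<close>, whose multiplicative extension is \<open>f\<close> of
  the generalized lcm times the weight with exponent \<open>- r\<close>. Positivity of the
  \<open>n i\<close> allows the weight to be inverted.\<close>

lemma f_gen_lcm_eq:
  assumes n: "n \<in> tuples k"
  shows "f (gen_lcm b k n)
    = of_real (\<Prod>i<k. real (n i) powr r) * (\<Sum>d\<in>PiE {..<k} (\<lambda>i. {d. d dvd n i}). diff_coeff d)"
proof -
  have pos: "n i > 0" if "i < k" for i using n that by (auto simp: tuples_def PiE_iff)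
  have "(\<Sum>d\<in>PiE {..<k} (\<lambda>i. {d. d dvd n i}). diff_coeff d)
      = mult_ext k (\<lambda>p v. \<Sum>w\<in>PiE {..<k} (\<lambda>i. {..v i}). local_diff p w) n"
    unfolding diff_coeff_def using n local_diff_tzero by (intro sum_dvd_mult_ext) auto
  also have "\<dots> = mult_ext k local_coeff n"
    unfolding mult_ext_def local_diff_def by (simp add: sum_tdiff)
  also have "\<dots> = f (gen_lcm b k n) * of_real (\<Prod>i<k. real (n i) powr (- r))"
    unfolding local_coeff_def mult_ext_weighted[OF n]
    using gen_lcm_mult_ext[OF mult_f _ k n, of b] b by simp
  finally have *: "(\<Sum>d\<in>PiE {..<k} (\<lambda>i. {d. d dvd n i}). diff_coeff d)
      = f (gen_lcm b k n) * of_real (\<Prod>i<k. real (n i) powr (- r))" .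
  have "(\<Prod>i<k. real (n i) powr r) * (\<Prod>i<k. real (n i) powr (- r)) = 1"
    unfolding prod.distrib[symmetric] using pos by (intro prod.neutral) (auto simp flip: powr_add)
  then have "complex_of_real (\<Prod>i<k. real (n i) powr r) * of_real (\<Prod>i<k. real (n i) powr (- r)) = 1"
    by (metis of_real_1 of_real_mult)
  then show ?thesis unfolding * by (simp add: mult.left_commute)
qed

text \<open>For fixed \<open>d\<close> the divisibility conditions restrict each coordinate of
  \<open>n\<close> separately, so after the exchange the inner sum is a product of \<open>k\<close>
  power sums over multiples.\<close>

lemma sum_f_gen_lcm:
  "(\<Sum>n\<in>pos_tuples_upto k x. f (gen_lcm b k n))
    = (\<Sum>d\<in>pos_tuples_upto k x. diff_coeff d * of_real (\<Prod>i<k. real (d i) powr r * power_sum r (x / real (d i))))"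
proof -
  define T where "T = pos_tuples_upto k x"
  define w where "w = (\<lambda>n. complex_of_real (\<Prod>i<k. real (n i) powr r))"
  have T: "n \<in> tuples k" "\<And>i. i < k \<Longrightarrow> 0 < n i" "\<And>i. i < k \<Longrightarrow> real (n i) \<le> x" if "n \<in> T" for n
    using that by (auto simp: T_def pos_tuples_upto_iff tuples_def PiE_iff)
  have fin: "finite T" by (simp add: T_def finite_pos_tuples_upto)
  have "(\<Sum>n\<in>T. f (gen_lcm b k n)) = (\<Sum>n\<in>T. \<Sum>d | d \<in> T \<and> (\<forall>i<k. d i dvd n i). w n * diff_coeff d)"
  proof (rule sum.cong[OF refl])
    fix n assume n: "n \<in> T"
    \<comment> \<open>Divisors of positive integers up to \<open>x\<close> lie in the same range.
      Hence \<open>d\<close> may be confined to \<open>T\<close> from the start, and the exchange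
      takes place between finite sets.\<close>
    have key: "1 \<le> d i \<and> real (d i) \<le> x" if "i < k" "d i dvd n i" for d i
    proof -
      have "d i \<le> n i" "1 \<le> d i"
        using that T(2)[OF n that(1)] by (auto simp: Suc_le_eq intro: dvd_imp_le dvd_pos_nat)
      then show ?thesis using T(3)[OF n that(1)] by linarith
    qed
    have "PiE {..<k} (\<lambda>i. {d. d dvd n i}) = {d \<in> T. \<forall>i<k. d i dvd n i}"
      unfolding T_def pos_tuples_upto_def
      by (intro set_eqI, simp only: PiE_iff mem_Collect_eq Ball_def lessThan_iff) (use key in blast)
    then show "f (gen_lcm b k n) = (\<Sum>d | d \<in> T \<and> (\<forall>i<k. d i dvd n i). w n * diff_coeff d)"
      using f_gen_lcm_eq[OF T(1)[OF n]] by (simp add: w_def sum_distrib_left)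
  qed
  also have "\<dots> = (\<Sum>d\<in>T. \<Sum>n | n \<in> T \<and> (\<forall>i<k. d i dvd n i). w n * diff_coeff d)"
    using fin by (rule sum.swap_restrict) (rule fin)
  also have "\<dots> = (\<Sum>d\<in>T. diff_coeff d * of_real (\<Prod>i<k. real (d i) powr r * power_sum r (x / real (d i))))"
  proof (rule sum.cong[OF refl])
    fix d assume d: "d \<in> T"
    have eq: "{n. n \<in> T \<and> (\<forall>i<k. d i dvd n i)} = PiE {..<k} (\<lambda>i. {m. 1 \<le> m \<and> real m \<le> x \<and> d i dvd m})"
      unfolding T_def pos_tuples_upto_def
      by (intro set_eqI, simp only: PiE_iff mem_Collect_eq Ball_def lessThan_iff) blast
    have "(\<Sum>n | n \<in> T \<and> (\<forall>i<k. d i dvd n i). \<Prod>i<k. real (n i) powr r)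
        = (\<Prod>i<k. \<Sum>m | 1 \<le> m \<and> real m \<le> x \<and> d i dvd m. real m powr r)"
      unfolding eq using finite_nat_real_le[of x]
      by (intro prod_sum_PiE[symmetric]) (auto intro: finite_subset[OF _ finite_nat_real_le[of x]])
    also have "\<dots> = (\<Prod>i<k. real (d i) powr r * power_sum r (x / real (d i)))"
      using T(2)[OF d] by (intro prod.cong refl sum_multiples_powr) auto
    finally have "(\<Sum>n | n \<in> T \<and> (\<forall>i<k. d i dvd n i). w n)
        = of_real (\<Prod>i<k. real (d i) powr r * power_sum r (x / real (d i)))"
      unfolding w_def of_real_sum[symmetric] by (rule arg_cong)
    then show "(\<Sum>n | n \<in> T \<and> (\<forall>i<k. d i dvd n i). w n * diff_coeff d)
        = diff_coeff d * of_real (\<Prod>i<k. real (d i) powr r * power_sum r (x / real (d i)))"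
      by (simp add: mult.commute flip: sum_distrib_right)
  qed
  finally show ?thesis by (simp add: T_def)
qed

section \<open>Absolute convergence, the Euler product and the error term\<close>

lemma abs_summable_diff_coeff:
  assumes e: "0 < e" and d: "\<delta> \<le> min (r + 1) 1 / 2 - e"
  shows "(\<lambda>n. diff_coeff n * of_real (\<Prod>i<k. real (n i) powr (- (1 - \<delta>)))) abs_summable_on tuples k"
proof -
  obtain K where K: "0 \<le> K"
    "\<And>p \<delta>. prime p \<Longrightarrow> \<delta> \<le> min (r + 1) 1 / 2 - e \<Longrightarrow>
      (\<lambda>w. local_diff p w * of_real (real p powr (- (1 - \<delta>) * real (tdeg k w)))) abs_summable_on exponent_tuples k"
    "\<And>p \<delta>. prime p \<Longrightarrow> \<delta> \<le> min (r + 1) 1 / 2 - e \<Longrightarrow>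
      infsum (\<lambda>w. cmod (local_diff p w * of_real (real p powr (- (1 - \<delta>) * real (tdeg k w))))) (exponent_tuples k - {tzero k})
        \<le> K * real p powr (- 1 - e / 2)"
    using local_diff_summable_bound[OF e] by blast
  define g where "g = (\<lambda>p w. local_diff p w * complex_of_real (real p powr (- (1 - \<delta>) * real (tdeg k w))))"
  have g0: "g p (tzero k) = 1" if "prime p" for p
    using that by (simp add: g_def local_diff_tzero prime_gt_0_nat)
  \<comment> \<open>The weight is part of the local factors. Each local absolute sum splits into 1
    from the zero tuple and a remainder at most \<open>K * p powr (- 1 - e / 2)\<close>, which is
    summable over \<open>p\<close>.\<close>
  have "mult_ext k g abs_summable_on tuples k"
  proof (rule abs_summable_mult_ext[where c = "\<lambda>p. K * real p powr (- 1 - e / 2)"])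
    show "g p (tzero k) = 1" if "prime p" for p by (rule g0[OF that])
    show sm: "g p abs_summable_on exponent_tuples k" if "prime p" for p
      unfolding g_def by (rule K(2)[OF that d])
    show "infsum (\<lambda>v. norm (g p v)) (exponent_tuples k) \<le> 1 + K * real p powr (- 1 - e / 2)" if "prime p" for p
    proof -
      have eq: "exponent_tuples k = insert (tzero k) (exponent_tuples k - {tzero k})" by auto
      have "(\<lambda>v. norm (g p v)) summable_on (exponent_tuples k - {tzero k})"
        using sm[OF that] by (rule summable_on_subset_banach) auto
      then have "infsum (\<lambda>v. norm (g p v)) (exponent_tuples k) = norm (g p (tzero k)) + infsum (\<lambda>v. norm (g p v)) (exponent_tuples k - {tzero k})"
        by (subst eq, subst infsum_insert) auto
      then show ?thesis using K(3)[OF that d] g0[OF that] by (simp add: g_def)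
    qed
    show "summable (\<lambda>p. K * real p powr (- 1 - e / 2))"
      using e by (intro summable_mult) (simp add: summable_real_powr_iff)
    show "0 \<le> K * real p powr (- 1 - e / 2)" for p using K(1) by simp
  qed
  then show ?thesis
    by (rule summable_on_cong[THEN iffD1, rotated]) (simp add: g_def diff_coeff_def mult_ext_weighted)
qed

text \<open>The factor \<open>(1 - 1 / p) ^ k\<close> is absorbed by taking differences, through the
  generating series identity at \<open>z = 1 / p\<close>.\<close>

lemma euler_factor_prime:
  assumes p: "prime p"
  shows "euler_factor b k r f p
    = infsum (\<lambda>w. local_diff p w * of_real (real p powr (- real (tdeg k w)))) (exponent_tuples k)"
proof -
  have lt: "local_term b k r f p = (\<lambda>v. local_coeff p v * (1 / of_nat p) ^ tdeg k v)"
    using p by (intro ext local_term_eq)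
  have "(1 - 1 / of_nat p) ^ k * infsum (local_term b k r f p) (exponent_tuples k)
     = infsum (\<lambda>w. local_diff p w * (1 / of_nat p) ^ tdeg k w) (exponent_tuples k)"
    unfolding lt local_diff_def
    by (rule infsum_tdiff[symmetric]) (use abs_summable_local_term[OF p] in \<open>simp add: lt\<close>)
  then show ?thesis using p
    by (simp add: euler_factor_def power_of_nat_inverse[OF prime_gt_0_nat])
qed

text \<open>Convergence is absolute, from summability of the distances of the factors to 1, so
  vanishing factors do no harm. The value follows because the partial products also tend to the sum
  over all tuples, and limits are unique.\<close>

lemma
  shows convergent_euler_factor: "convergent_prod (euler_factor b k r f)"
    and euler_const_eq: "euler_const b k r f
      = infsum (\<lambda>n. diff_coeff n * of_real (\<Prod>i<k. real (n i) powr (- 1))) (tuples k)"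
proof -
  \<comment> \<open>The largest choice that still admits \<delta> = 0, the unshifted weight
    \<open>n_i powr (- 1)\<close> being all that the constant requires.\<close>
  define e where "e = min (r + 1) 1 / 2"
  have e: "0 < e" "0 \<le> min (r + 1) 1 / 2 - e" using r by (auto simp: e_def)
  obtain K where K: "0 \<le> K"
    "\<And>p \<delta>. prime p \<Longrightarrow> \<delta> \<le> min (r + 1) 1 / 2 - e \<Longrightarrow>
      (\<lambda>w. local_diff p w * of_real (real p powr (- (1 - \<delta>) * real (tdeg k w)))) abs_summable_on exponent_tuples k"
    "\<And>p \<delta>. prime p \<Longrightarrow> \<delta> \<le> min (r + 1) 1 / 2 - e \<Longrightarrow>
      infsum (\<lambda>w. cmod (local_diff p w * of_real (real p powr (- (1 - \<delta>) * real (tdeg k w))))) (exponent_tuples k - {tzero k})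
        \<le> K * real p powr (- 1 - e / 2)"
    using local_diff_summable_bound[OF e(1)] by blast
  define g where "g = (\<lambda>p w. local_diff p w * complex_of_real (real p powr (- real (tdeg k w))))"
  have g0: "g p (tzero k) = 1" if "prime p" for p
    using that by (simp add: g_def local_diff_tzero prime_gt_0_nat)
  have sm: "g p abs_summable_on exponent_tuples k" if "prime p" for p
    using K(2)[OF that e(2)] by (simp add: g_def)
  have bd: "norm (euler_factor b k r f p - 1) \<le> K * real p powr (- 1 - e / 2)" for p
  proof (cases "prime p")
    case True
    have eq: "exponent_tuples k = insert (tzero k) (exponent_tuples k - {tzero k})" by auto
    have sm': "g p abs_summable_on (exponent_tuples k - {tzero k})"
      using sm[OF True] by (rule summable_on_subset_banach) auto
    have "euler_factor b k r f p = infsum (g p) (exponent_tuples k)"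
      using euler_factor_prime[OF True] by (simp add: g_def)
    also have "\<dots> = 1 + infsum (g p) (exponent_tuples k - {tzero k})"
      by (subst eq, subst infsum_insert) (use sm' True in \<open>auto simp: g0 intro: abs_summable_summable\<close>)
    finally have "norm (euler_factor b k r f p - 1) = norm (infsum (g p) (exponent_tuples k - {tzero k}))"
      by simp
    also have "\<dots> \<le> infsum (\<lambda>w. norm (g p w)) (exponent_tuples k - {tzero k})"
      by (rule norm_infsum_bound[OF sm'])
    also have "\<dots> \<le> K * real p powr (- 1 - e / 2)"
      using K(3)[OF True e(2)] by (simp add: g_def)
    finally show ?thesis .
  qed (use K in \<open>simp add: euler_factor_def\<close>)
  have "summable (\<lambda>p. K * real p powr (- 1 - e / 2))"
    using e by (intro summable_mult) (simp add: summable_real_powr_iff)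
  then have "summable (\<lambda>p. norm (euler_factor b k r f p - 1))"
    by (rule summable_comparison_test'[of _ 0]) (use bd in auto)
  then show conv: "convergent_prod (euler_factor b k r f)"
    by (intro abs_convergent_prod_imp_convergent_prod) (simp add: abs_convergent_prod_conv_summable)
  have geq: "mult_ext k g n = diff_coeff n * of_real (\<Prod>i<k. real (n i) powr (- 1))" if "n \<in> tuples k" for n
    using mult_ext_weighted[OF that, of local_diff "-1"] by (simp add: g_def diff_coeff_def)
  have "mult_ext k g abs_summable_on tuples k"
    using abs_summable_diff_coeff[OF e] by (rule summable_on_cong[THEN iffD1, rotated]) (simp add: geq)
  from euler_product_tendsto[OF g0 sm this]
  have "(\<lambda>N. \<Prod>p\<le>N. if prime p then infsum (g p) (exponent_tuples k) else 1) \<longlonglongrightarrow> infsum (mult_ext k g) (tuples k)" by simp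
  also have "(\<lambda>p. if prime p then infsum (g p) (exponent_tuples k) else 1) = euler_factor b k r f"
    using euler_factor_prime by (auto simp: g_def euler_factor_def fun_eq_iff)
  finally have "infsum (mult_ext k g) (tuples k) = prodinf (euler_factor b k r f)"
    using LIMSEQ_unique convergent_prod_LIMSEQ[OF conv] by blast
  moreover have "infsum (mult_ext k g) (tuples k) = infsum (\<lambda>n. diff_coeff n * of_real (\<Prod>i<k. real (n i) powr (- 1))) (tuples k)"
    by (rule infsum_cong) (rule geq)
  ultimately show "euler_const b k r f = infsum (\<lambda>n. diff_coeff n * of_real (\<Prod>i<k. real (n i) powr (- 1))) (tuples k)"
    by (simp add: euler_const_def)
qed

text \<open>Both the sum and its main term are written as sums over all tuples with the same
  coefficients \<open>diff_coeff n\<close>. Their difference can then be estimated term by term,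
  with no truncation and no separate tail.\<close>

lemma error_bound:
  assumes e: "0 < e" and d: "0 \<le> \<delta>" "\<delta> \<le> min (r + 1) 1 / 2 - e"
  obtains B where
    "\<And>x. 1 \<le> x \<Longrightarrow> cmod ((\<Sum>n\<in>pos_tuples_upto k x. f (gen_lcm b k n))
       - euler_const b k r f * complex_of_real (x powr (real k * (r + 1)) / (r + 1) ^ k))
      \<le> B * x powr (real k * (r + 1) - \<delta>)"
proof -
  have "\<delta> \<le> min (r + 1) 1" using d e r by (auto simp: min_def split: if_splits)
  then obtain K where K: "0 \<le> K"
    "\<And>y. 0 < y \<Longrightarrow> \<bar>power_sum r y - y powr (r + 1) / (r + 1)\<bar> \<le> K * y powr (r + 1 - \<delta>)"
    using power_sum_approx[OF r d(1)] by blast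
  \<comment> \<open>One constant to dominate the main term, which costs \<open>1 / (r + 1)\<close>,
    the deviation, which costs \<open>K\<close>, and their sum.\<close>
  define M where "M = 1 / (r + 1) + K"
  have M: "0 < M" "1 / (r + 1) \<le> M" "K \<le> M" using K r by (auto simp: M_def add_pos_nonneg)
  define W where "W = (\<lambda>n. \<Prod>i<k. real (n i) powr (- (1 - \<delta>)))"
  define S where "S = infsum (\<lambda>n. cmod (diff_coeff n * of_real (W n))) (tuples k)"
  have smW: "(\<lambda>n. cmod (diff_coeff n * of_real (W n))) summable_on tuples k"
    unfolding W_def by (rule abs_summable_diff_coeff[OF e d(2)])
  show ?thesis
  proof (rule that[of "real k * M ^ k * S"])
    fix x :: real assume x: "1 \<le> x"
    define A where "A = (\<lambda>(n :: nat \<Rightarrow> nat) i. real (n i) powr r * power_sum r (x / real (n i)))"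
    define G where "G = (\<lambda>(n :: nat \<Rightarrow> nat) i. real (n i) powr (- 1) * (x powr (r + 1) / (r + 1)))"
    \<comment> \<open>A common majorant of \<open>A\<close> and \<open>G\<close>, chosen so that the
      deviation is smaller by the factor \<open>x powr (- \<delta>)\<close>. Its product over the
      coordinates is, up to a constant, \<open>x powr (k * (r + 1))\<close> times the weight
      \<open>W n\<close>, against which \<open>diff_coeff\<close> is absolutely summable.\<close>
    define s where "s = (\<lambda>(n :: nat \<Rightarrow> nat) i. M * x powr (r + 1) * real (n i) powr (- (1 - \<delta>)))"
    define Z where "Z = (\<Sum>n\<in>pos_tuples_upto k x. f (gen_lcm b k n))"
    have pos: "1 \<le> real (n i)" if "n \<in> tuples k" "i < k" for n i
      using that by (auto simp: tuples_def PiE_iff Suc_le_eq)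

    \<comment> \<open>Extending the finite sum to all tuples changes nothing: if some component
      exceeds \<open>x\<close>, the corresponding power sum is empty and the product
      vanishes.\<close>
    have 1: "((\<lambda>n. diff_coeff n * of_real (\<Prod>i<k. A n i)) has_sum Z) (tuples k)"
    proof (rule has_sum_finite_neutralI)
      show "finite (pos_tuples_upto k x)" by (rule finite_pos_tuples_upto)
      show "pos_tuples_upto k x \<subseteq> tuples k" by (auto simp: pos_tuples_upto_iff)
      show "Z = (\<Sum>n\<in>pos_tuples_upto k x. diff_coeff n * of_real (\<Prod>i<k. A n i))"
        by (simp add: Z_def sum_f_gen_lcm A_def)
      show "diff_coeff n * of_real (\<Prod>i<k. A n i) = 0" if n: "n \<in> tuples k - pos_tuples_upto k x" for n
      proof -
        obtain i where i: "i < k" "x < real (n i)" using n by (auto simp: pos_tuples_upto_iff not_le)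
        then have "A n i = 0" using x by (simp add: A_def power_sum_less_1)
        then have "(\<Prod>i<k. A n i) = 0" using i by auto
        then show ?thesis by simp
      qed
    qed

    \<comment> \<open>The instance \<delta> = 0 of the summability statement, admissible because the
      given \<delta> is nonnegative.\<close>
    have "(\<lambda>n. diff_coeff n * complex_of_real (\<Prod>i<k. real (n i) powr (- 1))) abs_summable_on tuples k"
      using abs_summable_diff_coeff[OF e order_trans[OF d]] by simp
    then have "((\<lambda>n. diff_coeff n * complex_of_real (\<Prod>i<k. real (n i) powr (- 1))) has_sum euler_const b k r f) (tuples k)"
      unfolding euler_const_eq by (rule has_sum_infsum[OF abs_summable_summable])
    then have "((\<lambda>n. diff_coeff n * complex_of_real (\<Prod>i<k. real (n i) powr (- 1)) * of_real ((x powr (r + 1) / (r + 1)) ^ k))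
        has_sum euler_const b k r f * of_real ((x powr (r + 1) / (r + 1)) ^ k)) (tuples k)"
      by (rule has_sum_cmult_left)
    also have "(x powr (r + 1) / (r + 1)) ^ k = x powr (real k * (r + 1)) / (r + 1) ^ k"
      using x by (simp add: power_divide powr_powr mult.commute flip: powr_realpow)
    also have "(\<lambda>n. diff_coeff n * complex_of_real (\<Prod>i<k. real (n i) powr (- 1)) * of_real (x powr (real k * (r + 1)) / (r + 1) ^ k))
        = (\<lambda>n. diff_coeff n * of_real (\<Prod>i<k. G n i))"
      by (simp only: G_def prod.distrib prod_constant card_lessThan of_real_mult mult.assoc
        \<open>(x powr (r + 1) / (r + 1)) ^ k = _\<close>)
    finally have 2: "((\<lambda>n. diff_coeff n * of_real (\<Prod>i<k. G n i))
        has_sum euler_const b k r f * of_real (x powr (real k * (r + 1)) / (r + 1) ^ k)) (tuples k)" .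

    have "((\<lambda>n. diff_coeff n * of_real (\<Prod>i<k. A n i) - diff_coeff n * of_real (\<Prod>i<k. G n i))
      has_sum (Z - euler_const b k r f * of_real (x powr (real k * (r + 1)) / (r + 1) ^ k))) (tuples k)"
      using has_sum_add[OF 1 has_sum_uminusI[OF 2]] by simp
    moreover have "((\<lambda>n. (real k * M ^ k * x powr (real k * (r + 1) - \<delta>)) * cmod (diff_coeff n * of_real (W n)))
      has_sum (real k * M ^ k * x powr (real k * (r + 1) - \<delta>)) * S) (tuples k)"
      unfolding S_def by (intro has_sum_cmult_right has_sum_infsum smW)
    moreover have "cmod (diff_coeff n * of_real (\<Prod>i<k. A n i) - diff_coeff n * of_real (\<Prod>i<k. G n i))
      \<le> (real k * M ^ k * x powr (real k * (r + 1) - \<delta>)) * cmod (diff_coeff n * of_real (W n))"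
      if n: "n \<in> tuples k" for n
    proof -
      have "\<bar>(\<Prod>i<k. A n i) - (\<Prod>i<k. G n i)\<bar> \<le> real (card {..<k}) * x powr (- \<delta>) * (\<Prod>i<k. s n i)"
      proof (rule abs_prod_diff_le)
        fix i assume "i \<in> {..<k}"
        then have ni: "1 \<le> real (n i)" using pos[OF n] by simp
        define D where "D = real (n i)"
        have D: "1 \<le> D" using ni by (simp add: D_def)
        show "0 < s n i" using M x ni by (simp add: s_def)
        have powr_quot: "(x / D) powr c = x powr c * D powr (- c)" for c
          using x D by (simp add: powr_divide powr_minus_divide)
        have "D powr r * (x / D) powr (r + 1) = (D powr r * D powr (- (r + 1))) * x powr (r + 1)"
          by (simp only: powr_quot mult_ac)
        also have "D powr r * D powr (- (r + 1)) = D powr (- 1)" by (simp flip: powr_add)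
        finally have Geq: "G n i = D powr r * ((x / D) powr (r + 1) / (r + 1))"
          by (simp add: G_def D_def)
        have "D powr r * (x / D) powr (r + 1 - \<delta>) = (D powr r * D powr (- (r + 1 - \<delta>))) * x powr (r + 1 - \<delta>)"
          by (simp only: powr_quot mult_ac)
        also have "D powr r * D powr (- (r + 1 - \<delta>)) = D powr (- (1 - \<delta>))" by (simp flip: powr_add)
        also have "x powr (r + 1 - \<delta>) = x powr (- \<delta>) * x powr (r + 1)" by (simp flip: powr_add)
        finally have eq: "D powr r * (x / D) powr (r + 1 - \<delta>) = x powr (- \<delta>) * (x powr (r + 1) * D powr (- (1 - \<delta>)))"
          by (simp add: mult_ac)
        have "\<bar>A n i - G n i\<bar> = D powr r * \<bar>power_sum r (x / D) - (x / D) powr (r + 1) / (r + 1)\<bar>"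
          unfolding Geq A_def D_def[symmetric] right_diff_distrib[symmetric] abs_mult by simp
        also have "\<dots> \<le> D powr r * (K * (x / D) powr (r + 1 - \<delta>))"
          using x D by (intro mult_left_mono K) auto
        also have "\<dots> = K * (x powr (- \<delta>) * (x powr (r + 1) * D powr (- (1 - \<delta>))))"
          unfolding eq[symmetric] by (simp add: mult_ac)
        finally have diff: "\<bar>A n i - G n i\<bar> \<le> K * (x powr (- \<delta>) * (x powr (r + 1) * D powr (- (1 - \<delta>))))" .
        also have "\<dots> \<le> M * (x powr (- \<delta>) * (x powr (r + 1) * D powr (- (1 - \<delta>))))"
          using M by (intro mult_right_mono) auto
        finally show "\<bar>A n i - G n i\<bar> \<le> x powr (- \<delta>) * s n i"
          by (simp add: s_def D_def mult_ac)
        have "\<bar>G n i\<bar> = D powr (- 1) * (x powr (r + 1) / (r + 1))"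
          using r by (simp add: G_def D_def abs_mult)
        also have "\<dots> \<le> D powr (- (1 - \<delta>)) * (x powr (r + 1) / (r + 1))"
          using D d r by (intro mult_right_mono powr_mono) auto
        finally have Gb: "\<bar>G n i\<bar> \<le> 1 / (r + 1) * (x powr (r + 1) * D powr (- (1 - \<delta>)))"
          by (simp add: mult_ac)
        also have "\<dots> \<le> M * (x powr (r + 1) * D powr (- (1 - \<delta>)))"
          using M by (intro mult_right_mono) auto
        finally show "\<bar>G n i\<bar> \<le> s n i" by (simp add: s_def D_def mult_ac)
        \<comment> \<open>For \<open>x \<ge> 1\<close> the saving in the deviation may be dropped,
          so that the bounds for \<open>A - G\<close> and \<open>G\<close> add up to one for
          \<open>A\<close>.\<close>
        have "x powr (- \<delta>) \<le> x powr 0" using x d by (intro powr_mono) auto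
        then have "x powr (- \<delta>) * (x powr (r + 1) * D powr (- (1 - \<delta>))) \<le> 1 * (x powr (r + 1) * D powr (- (1 - \<delta>)))"
          using x by (intro mult_right_mono) auto
        then have "K * (x powr (- \<delta>) * (x powr (r + 1) * D powr (- (1 - \<delta>)))) \<le> K * (x powr (r + 1) * D powr (- (1 - \<delta>)))"
          using K(1) by (simp add: mult_left_mono)
        then have "\<bar>A n i\<bar> \<le> M * (x powr (r + 1) * D powr (- (1 - \<delta>)))"
          using diff Gb unfolding M_def distrib_right by linarith
        then show "\<bar>A n i\<bar> \<le> s n i" by (simp add: s_def D_def mult_ac)
      qed
      also have "(\<Prod>i<k. s n i) = M ^ k * x powr (real k * (r + 1)) * W n"
        using x by (simp add: s_def W_def prod.distrib power_mult_distrib powr_powr mult.commute flip: powr_realpow)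
      also have "real (card {..<k}) * x powr (- \<delta>) * (M ^ k * x powr (real k * (r + 1)) * W n)
          = real k * M ^ k * x powr (real k * (r + 1) - \<delta>) * W n"
        by (simp add: diff_conv_add_uminus powr_add del: add_uminus_conv_diff)
      finally have bound: "\<bar>(\<Prod>i<k. A n i) - (\<Prod>i<k. G n i)\<bar> \<le> real k * M ^ k * x powr (real k * (r + 1) - \<delta>) * W n" .
      have "0 \<le> W n" by (simp add: W_def prod_nonneg)
      have "cmod (diff_coeff n * of_real (\<Prod>i<k. A n i) - diff_coeff n * of_real (\<Prod>i<k. G n i))
          = cmod (diff_coeff n) * \<bar>(\<Prod>i<k. A n i) - (\<Prod>i<k. G n i)\<bar>"
        by (simp only: right_diff_distrib[symmetric] of_real_diff[symmetric] norm_mult norm_of_real)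
      also have "\<dots> \<le> cmod (diff_coeff n) * (real k * M ^ k * x powr (real k * (r + 1) - \<delta>) * W n)"
        by (intro mult_left_mono bound) auto
      also have "\<dots> = (real k * M ^ k * x powr (real k * (r + 1) - \<delta>)) * cmod (diff_coeff n * of_real (W n))"
        using \<open>0 \<le> W n\<close> by (simp add: norm_mult)
      finally show ?thesis .
    qed
    ultimately have "cmod (Z - euler_const b k r f * of_real (x powr (real k * (r + 1)) / (r + 1) ^ k))
        \<le> (real k * M ^ k * x powr (real k * (r + 1) - \<delta>)) * S"
      by (rule norm_infsum_le)
    then show "cmod ((\<Sum>n\<in>pos_tuples_upto k x. f (gen_lcm b k n))
       - euler_const b k r f * complex_of_real (x powr (real k * (r + 1)) / (r + 1) ^ k))
      \<le> real k * M ^ k * S * x powr (real k * (r + 1) - \<delta>)"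
      by (simp add: Z_def mult_ac)
  qed
qed

end

theorem theorem1p7:
  fixes b k :: nat and r :: real and f :: "nat \<Rightarrow> complex"
  assumes "2 \<le> b" and "2 \<le> k" and "-1 < r" and "f \<in> class_A r"
  shows "(\<forall>p::nat. prime p \<longrightarrow> local_term b k r f p summable_on exponent_tuples k) \<and>
    convergent_prod (euler_factor b k r f) \<and>
    (\<forall>\<epsilon>::real. 0 < \<epsilon> \<longrightarrow>
      (\<lambda>x::real. (\<Sum>n\<in>pos_tuples_upto k x. f (gen_lcm b k n))
          - euler_const b k r f
            * complex_of_real (x powr (real k * (r + 1)) / (r + 1) ^ k))
      \<in> O[at_top](\<lambda>x. complex_of_real
          (x powr (real k * (r + 1) - 1/2 * min (r + 1) 1 + \<epsilon>))))"
proof -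
  interpret lcm_sum b k r f using assms by unfold_locales auto
  show ?thesis
  proof (intro conjI allI impI)
    show "local_term b k r f p summable_on exponent_tuples k" if "prime p" for p
      using abs_summable_local_term[OF that] by (rule abs_summable_summable)
    show "convergent_prod (euler_factor b k r f)" by (rule convergent_euler_factor)
  next
    fix \<epsilon> :: real assume eps: "0 < \<epsilon>"
    define m where "m = min (r + 1) 1"
    \<comment> \<open>The value used for \<delta> is \<open>m / 2 - e\<close>: the bound by
      \<epsilon> keeps the loss in the exponent small enough, and the bound \<open>m / 4\<close>
      keeps \<delta> nonnegative even for large \<epsilon>.\<close>
    define e where "e = min \<epsilon> (m / 4)"
    have m: "0 < m" using assms by (simp add: m_def)
    then have e: "0 < e" "0 \<le> m / 2 - e" "e \<le> \<epsilon>" using eps by (auto simp: e_def)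
    obtain B where B: "\<And>x. 1 \<le> x \<Longrightarrow> cmod ((\<Sum>n\<in>pos_tuples_upto k x. f (gen_lcm b k n))
       - euler_const b k r f * complex_of_real (x powr (real k * (r + 1)) / (r + 1) ^ k))
      \<le> B * x powr (real k * (r + 1) - (m / 2 - e))"
      using error_bound[OF e(1), of "m / 2 - e"] e by (auto simp: m_def)
    show "(\<lambda>x::real. (\<Sum>n\<in>pos_tuples_upto k x. f (gen_lcm b k n))
          - euler_const b k r f
            * complex_of_real (x powr (real k * (r + 1)) / (r + 1) ^ k))
      \<in> O[at_top](\<lambda>x. complex_of_real
          (x powr (real k * (r + 1) - 1/2 * min (r + 1) 1 + \<epsilon>)))"
    proof (rule bigoI[where c = "\<bar>B\<bar>"])
      show "\<forall>\<^sub>F x in at_top. cmod ((\<Sum>n\<in>pos_tuples_upto k x. f (gen_lcm b k n))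
          - euler_const b k r f * complex_of_real (x powr (real k * (r + 1)) / (r + 1) ^ k))
        \<le> \<bar>B\<bar> * cmod (complex_of_real (x powr (real k * (r + 1) - 1/2 * min (r + 1) 1 + \<epsilon>)))"
        using eventually_ge_at_top[of 1]
      proof eventually_elim
        fix x :: real assume x: "1 \<le> x"
        have "B * x powr (real k * (r + 1) - (m / 2 - e))
            \<le> \<bar>B\<bar> * x powr (real k * (r + 1) - 1/2 * min (r + 1) 1 + \<epsilon>)"
          using x e by (intro mult_mono powr_mono) (auto simp: m_def)
        then show "cmod ((\<Sum>n\<in>pos_tuples_upto k x. f (gen_lcm b k n))
          - euler_const b k r f * complex_of_real (x powr (real k * (r + 1)) / (r + 1) ^ k))
        \<le> \<bar>B\<bar> * cmod (complex_of_real (x powr (real k * (r + 1) - 1/2 * min (r + 1) 1 + \<epsilon>)))"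
          using B[OF x] by simp
      qed
    qed
  qed
qed

end
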